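(* There exists a continuous function $f\in\Phi_2$ such that $\operatorname{supp} f\subset[0,31/10]\subset[0,\pi)$ and $$\int_0^{31/10} f(t)\,P_2(\cos t)\,\sin t\,dt<0,$$ where $P_2(x)=(3x^2-1)/2$ is the Legendre polynomial of degree two. In particular, $f|_{[0,\pi]}\notin\Psi_2$.
   Context: $\Phi_d$ is the class of continuous functions $\phi:[0,\infty)\to\mathbb{R}$ with $\phi(0)=1$ such that the kernel $(x,y)\mapsto\phi(|x-y|)$ is positive definite on $\mathbb{R}^d$, i.e. $\sum_{i,j=1}^N\overline{c_i}c_j\,\phi(|x_i-x_j|)\ge 0$ for all $N\ge1$, $x_1,\dots,x_N\in\mathbb{R}^d$, $c_1,\dots,c_N\in\mathbb{C}$. $\Psi_d$ is the class of continuous functions $\psi:[0,\pi]\to\mathbb{R}$ with $\psi(0)=1$ such that the kernel $(\xi,\eta)\mapsto\psi(\arccos(\xi\cdot\eta))$ is positive definite (in the same, non-strict sense) on the unit sphere $\mathbb{S}^d=\{x\in\mathbb{R}^{d+1}:|x|=1\}$. *)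

theory Defs
  imports "HOL-Analysis.Analysis"
begin

text \<open>A (non-strictly) positive definite real-valued kernel on a set \<open>S\<close>: membership in
  \<open>\<real>\<^sub>\<ge>\<^sub>0\<close> says that the complex sum is real and nonnegative.\<close>

definition pos_def_kernel_on :: "'a set \<Rightarrow> ('a \<Rightarrow> 'a \<Rightarrow> real) \<Rightarrow> bool" where
  "pos_def_kernel_on S K \<longleftrightarrow>
     (\<forall>N\<ge>1. \<forall>(x :: nat \<Rightarrow> 'a) (c :: nat \<Rightarrow> complex). (\<forall>i\<in>{1..N}. x i \<in> S) \<longrightarrow>
        (\<Sum>i=1..N. \<Sum>j=1..N. cnj (c i) * c j * of_real (K (x i) (x j))) \<in> \<real>\<^sub>\<ge>\<^sub>0)"

text \<open>A function with domain \<open>[0,\<infinity>)\<close> or \<open>[0,\<pi>]\<close> is represented by a total function on the reals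
  whose values off that domain are irrelevant. The classes are indexed by the ambient Euclidean
  space: \<open>\<Phi>\<^sub>d\<close> is \<open>Phi TYPE('a)\<close> with \<open>DIM('a) = d\<close>, whereas \<open>\<Psi>\<^sub>d\<close> is \<open>Psi TYPE('a)\<close> with
  \<open>DIM('a) = d + 1\<close>, because the unit sphere of \<open>'a\<close> has dimension one less than \<open>'a\<close>.\<close>

definition Phi :: "'a::euclidean_space itself \<Rightarrow> (real \<Rightarrow> real) set" where
  "Phi _ = {\<phi>. continuous_on {0..} \<phi> \<and> \<phi> 0 = 1 \<and>
     pos_def_kernel_on (UNIV :: 'a set) (\<lambda>x y. \<phi> (norm (x - y)))}"

definition Psi :: "'a::euclidean_space itself \<Rightarrow> (real \<Rightarrow> real) set" where
  "Psi _ = {\<psi>. continuous_on {0..pi} \<psi> \<and> \<psi> 0 = 1 \<and>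
     pos_def_kernel_on (sphere (0 :: 'a) 1) (\<lambda>\<xi> \<eta>. \<psi> (arccos (\<xi> \<bullet> \<eta>)))}"

abbreviation Phi_2 :: "(real \<Rightarrow> real) set" where
  "Phi_2 \<equiv> Phi TYPE(real ^ 2)"

abbreviation Psi_2 :: "(real \<Rightarrow> real) set" where
  "Psi_2 \<equiv> Psi TYPE(real ^ 3)"

definition legendre_P2 :: "real \<Rightarrow> real" where
  "legendre_P2 x = (3 * x\<^sup>2 - 1) / 2"

end

theory Submission
  imports Defs
begin

text \<open>
  Two facts are combined: a construction in the plane and a necessary condition on the sphere.

  \<^bold>\<open>The plane.\<close> Since \<open>P\<^sub>2(cos t) sin t = t W(t) / 2\<close> with \<open>W(t) = (2 sin t - 3 sin\<^sup>3 t) / t\<close>,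
  polar coordinates turn the integral in question into a multiple of the integral of
  \<open>f(|z|) W(|z|)\<close> over the plane. If \<open>f(|z|)\<close> is the rotational mean of the autocorrelation of a
  measure with masses \<open>m\<^sub>p\<close> at sites \<open>x\<^sub>p\<close>, this is a multiple of the energy
  \<open>\<Sum> m\<^sub>p m\<^sub>q W(|x\<^sub>p - x\<^sub>q|)\<close>, so a finite configuration of negative energy in a disc of diameter less
  than \<open>31/10\<close> is all that is needed. That negative energies occur can be expected, because the planar
  Fourier transform of \<open>W(|z|)\<close> is proportional to \<open>3 / sqrt (9 - k\<^sup>2) - 1 / sqrt (1 - k\<^sup>2)\<close> (each term
  being present only where its root is real), which is negative for \<open>0 < k < 1\<close>; that they occur in so small
  a disc is a matter of computation. The configuration chosen here has mass \<open>2\<close> at the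
  centre and mass \<open>1\<close> at each vertex of a regular hexagon of radius \<open>3/2\<close>; its energy is
  \<open>20 + 36 W(3/2) + 12 W(3 sqrt 3 / 2) + 6 W(3)\<close>, about \<open>-0.17\<close>
  (\<open>interaction_energy_negative\<close>).

  Point masses do not give a continuous function, so they are smeared over squares of side \<open>e\<close>. The
  autocorrelation of the indicator of a square is positive definite because overlap measures
  \<open>\<mu>(A\<^sub>i \<inter> A\<^sub>j)\<close> form a Gram matrix, and by continuity of \<open>W\<close> the energy stays negative once \<open>e\<close> is small.
  The mean over rotations makes the function radial and keeps it positive definite. This gives
  \<open>Phi_2_example\<close>.

  \<^bold>\<open>The sphere.\<close> A function \<open>\<psi> \<in> \<Psi>\<^sub>2\<close> has a nonnegative second Legendre coefficient
  (\<open>Psi_integral_nonneg\<close>). On unit vectors \<open>P\<^sub>2(\<xi> \<bullet> \<eta>)\<close> is \<open>3/2\<close> times the inner product of the trace-free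
  matrices \<open>\<xi>\<xi>\<^sup>T - I/3\<close> and \<open>\<eta>\<eta>\<^sup>T - I/3\<close>, so the product kernel \<open>\<psi>(arccos (\<xi> \<bullet> \<eta>)) P\<^sub>2(\<xi> \<bullet> \<eta>)\<close> is positive
  definite, and its double integral is nonnegative. The averages are taken over the unit ball of
  three-space, with \<open>\<xi> = x / |x|\<close>. Lebesgue measure being invariant under rotations, the inner integral
  does not depend on \<open>\<eta>\<close>; spherical coordinates show that it is a positive multiple of the
  coefficient. For the function \<open>f\<close> of the first part the coefficient is negative, so the restriction
  of \<open>f\<close> is not in \<open>\<Psi>\<^sub>2\<close>.
\<close>

section \<open>The radial weight and a seven-point configuration of negative energy\<close>

text \<open>The value at \<open>0\<close> is the limit, so that the weight is continuous and the diagonal terms of the energy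
  below carry their true value.\<close>

definition weight :: "real \<Rightarrow> real" where
  "weight t = (if t = 0 then 2 else (2 * sin t - 3 * sin t ^ 3) / t)"

lemma weight_mult: "weight t * t = 2 * sin t - 3 * sin t ^ 3"
  by (simp add: weight_def)

lemma legendre_P2_sin: "legendre_P2 (cos t) * sin t = weight t * t / 2"
proof -
  have "legendre_P2 (cos t) * sin t = (3 * (1 - (sin t)\<^sup>2) - 1) / 2 * sin t"
    by (simp add: legendre_P2_def cos_squared_eq)
  also have "\<dots> = (2 * sin t - 3 * sin t ^ 3) / 2"
    by (simp add: field_simps power2_eq_square power3_eq_cube)
  finally show ?thesis
    by (simp only: weight_mult)
qed

lemma continuous_weight: "continuous_on UNIV weight"
proof -
  have "isCont weight t" for t
  proof (cases "t = 0")
    case True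
    have "((\<lambda>h. sin h / h) \<longlongrightarrow> (1::real)) (at 0)"
      using DERIV_sin[of 0] by (simp add: DERIV_def)
    then have "((\<lambda>h. sin h / h * (2 - 3 * (sin h)\<^sup>2)) \<longlongrightarrow> 1 * (2 - 3 * (sin 0)\<^sup>2)) (at (0::real))"
      by (intro tendsto_intros)
    then have "(weight \<longlongrightarrow> 2) (at 0)"
      by (rule tendsto_eq_rhs[OF Lim_transform_eventually])
         (auto simp: eventually_at_filter weight_def field_simps power2_eq_square power3_eq_cube)
    with True show ?thesis by (simp add: isCont_def weight_def)
  next
    case False
    have "isCont (\<lambda>t. (2 * sin t - 3 * sin t ^ 3) / t) t"
      using False by (intro continuous_intros) auto
    moreover have "\<forall>\<^sub>F s in nhds t. weight s = (2 * sin s - 3 * sin s ^ 3) / s"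
      using t1_space_nhds[OF False] by (rule eventually_mono) (simp add: weight_def)
    ultimately show ?thesis by (simp add: isCont_cong)
  qed
  then show ?thesis by (simp add: continuous_on_eq_continuous_at)
qed

text \<open>Coordinates of the sites with respect to a triangular lattice: in these, squared distances are
  values of the form \<open>a\<^sup>2 + a b + b\<^sup>2\<close>, and only the four values \<open>0, 1, 3, 4\<close> occur between sites.\<close>

definition hexagon :: "(int \<times> int) set" where
  "hexagon = {(0,0), (1,0), (0,1), (-1,1), (-1,0), (0,-1), (1,-1)}"

definition mass :: "int \<times> int \<Rightarrow> real" where
  "mass p = (if p = (0,0) then 2 else 1)"

definition site :: "int \<times> int \<Rightarrow> real ^ 2" where
  "site p = vector [3/4 * of_int (2 * fst p + snd p), 3/4 * sqrt 3 * of_int (snd p)]"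

lemma finite_hexagon: "finite hexagon"
  by (simp add: hexagon_def)

lemma norm_site_diff:
  "norm (site (a, b) - site (a', b')) =
     3/2 * sqrt (of_int ((a - a')\<^sup>2 + (a - a') * (b - b') + (b - b')\<^sup>2))"
proof -
  have "norm (site (a, b) - site (a', b')) =
     sqrt ((3/2)\<^sup>2 * of_int ((a - a')\<^sup>2 + (a - a') * (b - b') + (b - b')\<^sup>2))"
    unfolding norm_vec_def L2_set_def
    apply (rule arg_cong[where f=sqrt])
    apply (simp add: site_def UNIV_2 power2_eq_square algebra_simps)
    done
  then show ?thesis by (simp add: real_sqrt_mult)
qed

lemma norm_site: "p \<in> hexagon \<Longrightarrow> norm (site p) \<le> 3/2"
proof -
  assume p: "p \<in> hexagon"
  have "site (0, 0) = 0"
    by (simp add: site_def vec_eq_iff forall_2)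
  with norm_site_diff[of "fst p" "snd p" 0 0] p show ?thesis
    by (auto simp: hexagon_def)
qed

text \<open>The maximum of the left side is \<open>4 sqrt 2 / 9\<close>, attained at \<open>sqrt 2 / 3\<close>. The proof uses the slightly
  larger rational \<open>33/70\<close> in place of that point.\<close>

lemma cubic_bound:
  fixes y :: real
  assumes "0 \<le> y"
  shows "2 * y - 3 * y ^ 3 \<le> 63/100"
proof -
  \<comment> \<open>The cubic \<open>y\<^sup>3 - 3 a\<^sup>2 y + 2 a\<^sup>3\<close> has the double root \<open>a\<close> and the root \<open>- 2 a\<close>.\<close>
  have "0 \<le> 3 * ((y - 33/70)\<^sup>2 * (y + 33/35))"
    using assms by simp
  also have "\<dots> = 3 * y ^ 3 - 9801/4900 * y + 6 * (33/70) ^ 3"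
    by (simp add: power2_eq_square power3_eq_cube field_simps)
  finally have "9801/4900 * y - 3 * y ^ 3 \<le> 63/100"
    by (simp add: power3_eq_cube)
  with assms show ?thesis by linarith
qed

text \<open>Counting pairs by distance leaves three values of the weight. The term at \<open>3/2\<close> is the large
  negative one: there the sine is close to \<open>1\<close>. At distance \<open>3 sqrt 3 / 2\<close> the crude bound on the
  cubic suffices, and at distance \<open>3\<close> the sine is small because \<open>3\<close> is close to \<open>\<pi>\<close>.\<close>

lemma interaction_energy_negative:
  "(\<Sum>p\<in>hexagon. \<Sum>q\<in>hexagon. mass p * mass q * weight (norm (site p - site q))) < 0"
proof -
  have eq: "(\<Sum>p\<in>hexagon. \<Sum>q\<in>hexagon. mass p * mass q * weight (norm (site p - site q))) =
     20 + 36 * weight (3/2) + 12 * weight (3/2 * sqrt 3) + 6 * weight 3"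
    unfolding hexagon_def mass_def by (simp add: norm_site_diff weight_def[of 0])
  have pi: "3.1415 < pi" "pi < 3.1416" using pi_approx by simp_all
  have w1: "weight (3/2) \<le> - 654/1000"
  proof -
    \<comment> \<open>The sine at \<open>3/2\<close> is \<open>cos x = 1 - 2 sin\<^sup>2 (x/2)\<close> for this small \<open>x\<close>.\<close>
    define x where "x = pi/2 - 3/2"
    have x: "0 \<le> x" "x \<le> 708/10000" using pi by (auto simp: x_def)
    have "(sin (x/2))\<^sup>2 \<le> (708/20000)\<^sup>2"
      using x sin_x_le_x[of "x/2"] sin_ge_zero[of "x/2"] pi by (intro power_mono) auto
    moreover have "sin (3/2) = cos x"
      by (simp add: cos_diff x_def)
    then have "sin (3/2) = 1 - 2 * (sin (x/2))\<^sup>2"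
      using cos_double_sin[of "x/2"] by simp
    ultimately have y: "9974/10000 \<le> sin (3/2::real)"
      by (simp add: power2_eq_square)
    have "(9974/10000)\<^sup>2 * sin (3/2) \<le> (sin (3/2))\<^sup>2 * sin (3/2::real)"
      using y by (intro mult_right_mono power_mono) auto
    also have "\<dots> = sin (3/2) ^ 3"
      by (simp add: power2_eq_square power3_eq_cube)
    finally have "2 * sin (3/2) - 3 * sin (3/2) ^ 3 \<le> 2 * sin (3/2) - 3 * ((9974/10000)\<^sup>2 * sin (3/2::real))"
      by simp
    also have "\<dots> \<le> (2 - 3 * (9974/10000)\<^sup>2) * (9974/10000)"
      using y by (simp add: power2_eq_square)
    finally show ?thesis by (simp add: weight_def power2_eq_square)
  qed
  have w2: "weight (3/2 * sqrt 3) \<le> 243/1000"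
  proof -
    have s: "1.732 \<le> sqrt (3::real)" by (rule real_le_rsqrt) (simp add: power2_eq_square)
    have s': "sqrt (3::real) \<le> 1.75" by (rule real_le_lsqrt) (simp_all add: power2_eq_square)
    define t where "t = 3/2 * sqrt (3::real)"
    have t: "2.598 \<le> t" "t < pi" using s s' pi by (auto simp: t_def)
    then have "0 \<le> sin t" by (intro sin_ge_zero) auto
    then have "weight t * t \<le> 63/100"
      unfolding weight_mult by (rule cubic_bound)
    then have "weight t \<le> (63/100) / t"
      using t by (simp add: pos_le_divide_eq)
    also have "\<dots> \<le> (63/100) / 2.598"
      using t by (intro divide_left_mono) auto
    finally show ?thesis by (simp add: t_def)
  qed
  have w3: "weight 3 \<le> 96/1000"
  proof -
    have "0 \<le> sin (pi - 3)" "sin (pi - 3) \<le> pi - 3"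
      using pi by (intro sin_ge_zero sin_x_le_x; simp)+
    then have "0 \<le> sin (3::real)" "sin (3::real) \<le> 1416/10000"
      using pi by auto
    moreover from this have "0 \<le> sin (3::real) ^ 3" by simp
    ultimately have "2 * sin 3 - 3 * sin 3 ^ 3 \<le> (2832/10000::real)" by linarith
    then show ?thesis by (simp add: weight_def)
  qed
  show ?thesis unfolding eq using w1 w2 w3 by linarith
qed

section \<open>Positive definite kernels from overlaps of sets\<close>

text \<open>For a symmetric kernel the mixed terms between real and imaginary parts of the coefficients cancel,
  so real coefficients suffice.\<close>

lemma pos_def_kernel_onI:
  assumes sym: "\<And>x y. K x y = K y x"
    and psd: "\<And>(N::nat) x c. (\<And>i. i \<in> {1..N} \<Longrightarrow> x i \<in> S) \<Longrightarrow>
      0 \<le> (\<Sum>i=1..N. \<Sum>j=1..N. c i * c j * K (x i) (x j))"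
  shows "pos_def_kernel_on S K"
  unfolding pos_def_kernel_on_def
proof (intro allI impI)
  fix N :: nat and x :: "nat \<Rightarrow> 'a" and c :: "nat \<Rightarrow> complex"
  assume x: "\<forall>i\<in>{1..N}. x i \<in> S"
  let ?s = "\<Sum>i=1..N. \<Sum>j=1..N. cnj (c i) * c j * of_real (K (x i) (x j))"
  have "Re ?s = (\<Sum>i=1..N. \<Sum>j=1..N. Re (c i) * Re (c j) * K (x i) (x j))
      + (\<Sum>i=1..N. \<Sum>j=1..N. Im (c i) * Im (c j) * K (x i) (x j))"
    by (simp add: sum.distrib[symmetric] algebra_simps)
  moreover have "Im ?s = (\<Sum>i=1..N. \<Sum>j=1..N. Re (c i) * Im (c j) * K (x i) (x j))
      - (\<Sum>i=1..N. \<Sum>j=1..N. Im (c i) * Re (c j) * K (x i) (x j))"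
    by (simp add: sum_subtractf[symmetric] algebra_simps)
  moreover have "(\<Sum>i=1..N. \<Sum>j=1..N. Re (c i) * Im (c j) * K (x i) (x j))
      = (\<Sum>i=1..N. \<Sum>j=1..N. Im (c i) * Re (c j) * K (x i) (x j))"
    by (subst sum.swap) (simp add: sym mult.commute)
  ultimately show "?s \<in> \<real>\<^sub>\<ge>\<^sub>0"
    using psd[of N x "\<lambda>i. Re (c i)"] psd[of N x "\<lambda>i. Im (c i)"] x
    by (simp add: complex_nonneg_Reals_iff)
qed

lemma pos_def_kernel_onD:
  assumes K: "pos_def_kernel_on S K" and I: "finite I" and x: "\<And>i. i \<in> I \<Longrightarrow> x i \<in> S"
  shows "0 \<le> (\<Sum>i\<in>I. \<Sum>j\<in>I. c i * c j * K (x i) (x j))"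
proof (cases "I = {}")
  case False
  obtain b where b: "bij_betw b {1..card I} I"
    using ex_bij_betw_nat_finite_1[OF I] by blast
  have "1 \<le> card I"
    using False I by (simp add: Suc_le_eq card_gt_0_iff)
  moreover have "\<forall>i\<in>{1..card I}. x (b i) \<in> S"
    using b x by (auto simp: bij_betw_def)
  ultimately have "(\<Sum>i=1..card I. \<Sum>j=1..card I. cnj (of_real (c (b i))) * of_real (c (b j)) *
      of_real (K (x (b i)) (x (b j)))) \<in> \<real>\<^sub>\<ge>\<^sub>0"
    using K unfolding pos_def_kernel_on_def 
    by (elim allE[of _ "card I"] allE[of _ "\<lambda>i. x (b i)"] allE[of _ "\<lambda>i. of_real (c (b i))"] impE) 
  then have "of_real (\<Sum>i=1..card I. \<Sum>j=1..card I. c (b i) * c (b j) * K (x (b i)) (x (b j)))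
      \<in> (\<real>\<^sub>\<ge>\<^sub>0 :: complex set)"
    by simp
  then have "0 \<le> (\<Sum>i=1..card I. \<Sum>j=1..card I. c (b i) * c (b j) * K (x (b i)) (x (b j)))"
    by (simp only: nonneg_Reals_of_real_iff)
  also have "\<dots> = (\<Sum>i\<in>I. \<Sum>j\<in>I. c i * c j * K (x i) (x j))"
    by (simp add: sum.reindex_bij_betw[OF b, symmetric])
  finally show ?thesis .
qed simp

text \<open>The quadratic form is the integral of the square of the function \<open>\<Sum> c\<^sub>i 1\<^bsub>A\<^sub>i\<^esub>\<close>.\<close>

lemma overlap_pos_semidef:
  fixes c :: "'i \<Rightarrow> real"
  assumes I: "finite I" and A: "\<And>i. i \<in> I \<Longrightarrow> A i \<in> fmeasurable M"
  shows "0 \<le> (\<Sum>i\<in>I. \<Sum>j\<in>I. c i * c j * measure M (A i \<inter> A j))"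
proof -
  have int: "integrable M (\<lambda>x. c i * c j * indicator (A i \<inter> A j) x)" if "i \<in> I" "j \<in> I" for i j
    using fmeasurable_Int_fmeasurable[OF A[OF that(1)] fmeasurableD[OF A[OF that(2)]]]
    by (intro integrable_mult_right) (simp add: fmeasurable_def integrable_indicator_iff)
  have "0 \<le> (\<integral>x. (\<Sum>i\<in>I. c i * indicator (A i) x)\<^sup>2 \<partial>M)"
    by (intro integral_nonneg_AE) simp
  also have "\<dots> = (\<integral>x. (\<Sum>i\<in>I. \<Sum>j\<in>I. c i * c j * indicator (A i \<inter> A j) x) \<partial>M)"
    by (simp add: power2_eq_square sum_product indicator_inter_arith ac_simps)
  also have "\<dots> = (\<Sum>i\<in>I. \<Sum>j\<in>I. \<integral>x. c i * c j * indicator (A i \<inter> A j) x \<partial>M)"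
    using int by (simp add: Bochner_Integration.integral_sum)
  also have "\<dots> = (\<Sum>i\<in>I. \<Sum>j\<in>I. c i * c j * measure M (A i \<inter> A j))"
    using A by (intro sum.cong refl) (simp add: Int_absorb2 fmeasurable_def sets.sets_into_space le_infI1)
  finally show ?thesis .
qed

text \<open>The autocorrelation of the indicator function of a square of side \<open>e\<close>, which makes it positive definite
  (\<open>bump_overlap\<close>).\<close>

definition bump :: "real \<Rightarrow> real ^ 2 \<Rightarrow> real" where
  "bump e z = max 0 (e - \<bar>z $ 1\<bar>) * max 0 (e - \<bar>z $ 2\<bar>)"

lemma ex_2_iff: "(\<exists>i::2. P i) \<longleftrightarrow> P 1 \<or> P 2"
  using forall_2[of "\<lambda>i. \<not> P i"] by blast

lemma bump_overlap:
  assumes "0 < e"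
  shows "bump e (p - q) = measure lborel (cbox p (p + vec e) \<inter> cbox q (q + vec e))"
proof -
  have "measure lborel (cbox p (p + vec e) \<inter> cbox q (q + vec e)) =
     measure lborel (cbox (\<chi> i. max (p $ i) (q $ i)) (\<chi> i. min (p $ i + e) (q $ i + e)))"
    by (rule arg_cong[where f="measure lborel"]) (auto simp: mem_box_cart)
  also have "\<dots> = bump e (p - q)"
  proof -
    have overlap: "min (a + e) (b + e) - max a b = e - \<bar>a - b\<bar>" for a b :: real
      by (auto simp: min_def max_def)
    show ?thesis
      using assms by (auto simp: overlap content_cbox_if_cart interval_eq_empty_cart UNIV_2 ex_2_iff bump_def)
  qed
  finally show ?thesis by simp
qed

section \<open>Polar coordinates and means over circles\<close>

definition rotation :: "real \<Rightarrow> real ^ 2 \<Rightarrow> real ^ 2" where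
  "rotation \<theta> z = vector [cos \<theta> * z $ 1 - sin \<theta> * z $ 2, sin \<theta> * z $ 1 + cos \<theta> * z $ 2]"

definition polar :: "real \<Rightarrow> real \<Rightarrow> real ^ 2" where
  "polar r \<theta> = vector [r * cos \<theta>, r * sin \<theta>]"

lemma norm_real2: "(norm z)\<^sup>2 = (z $ 1)\<^sup>2 + (z $ 2)\<^sup>2" for z :: "real ^ 2"
  by (simp add: norm_vec_def L2_set_def UNIV_2)

lemma norm_polar [simp]: "norm (polar r \<theta>) = \<bar>r\<bar>"
proof (rule power2_eq_imp_eq)
  have "(r * cos \<theta>)\<^sup>2 + (r * sin \<theta>)\<^sup>2 = r\<^sup>2"
    by (simp only: power_mult_distrib distrib_left[symmetric] sin_cos_squared_add2 mult_1_right)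
  then show "(norm (polar r \<theta>))\<^sup>2 = \<bar>r\<bar>\<^sup>2"
    by (simp add: norm_real2 polar_def)
qed auto

lemma rotation_polar: "rotation \<phi> (polar r \<theta>) = polar r (\<theta> + \<phi>)"
  by (simp add: rotation_def polar_def vec_eq_iff forall_2 cos_add sin_add algebra_simps)

lemma rotation_diff: "rotation \<phi> (x - y) = rotation \<phi> x - rotation \<phi> y"
  by (simp add: rotation_def vec_eq_iff forall_2 algebra_simps)

lemma polar_surj: obtains \<theta> where "0 \<le> \<theta>" "\<theta> < 2 * pi" "z = polar (norm z) \<theta>"
proof (cases "z = 0")
  case True
  then show ?thesis
    by (intro that[of 0]) (auto simp: polar_def vec_eq_iff forall_2)
next
  case False
  have "(z $ 1 / norm z)\<^sup>2 + (z $ 2 / norm z)\<^sup>2 = ((z $ 1)\<^sup>2 + (z $ 2)\<^sup>2) / (norm z)\<^sup>2"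
    by (simp add: power_divide add_divide_distrib)
  also have "\<dots> = 1"
    using False by (simp add: norm_real2[symmetric])
  finally obtain \<theta> where \<theta>: "0 \<le> \<theta>" "\<theta> < 2 * pi" "z $ 1 / norm z = cos \<theta>" "z $ 2 / norm z = sin \<theta>"
    by (rule sincos_total_2pi)
  have "z $ 1 = norm z * cos \<theta>" "z $ 2 = norm z * sin \<theta>"
    using False unfolding \<theta>(3,4)[symmetric] by simp_all
  then have "z = polar (norm z) \<theta>"
    by (simp add: polar_def vec_eq_iff forall_2)
  with \<theta>(1,2) show ?thesis by (rule that)
qed

lemma continuous_on_vector_2 [continuous_intros]:
  assumes "continuous_on A f" "continuous_on A g"
  shows "continuous_on A (\<lambda>x. vector [f x, g x] :: real ^ 2)"
proof -
  have "continuous_on A (\<lambda>x. \<chi> i::2. if i = 1 then f x else g x)"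
    by (intro continuous_on_vec_lambda, rename_tac i, case_tac "i = 1") (auto intro: assms)
  also have "(\<lambda>x. \<chi> i::2. if i = 1 then f x else g x) = (\<lambda>x. vector [f x, g x])"
    by (auto simp: fun_eq_iff vec_eq_iff forall_2)
  finally show ?thesis .
qed

lemma continuous_on_polar [continuous_intros]:
  fixes A :: "'a::t2_space set"
  shows "continuous_on A f \<Longrightarrow> continuous_on A g \<Longrightarrow> continuous_on A (\<lambda>x. polar (f x) (g x))"
  unfolding polar_def by (auto intro!: continuous_intros)

lemma integral_periodic_shift:
  fixes F :: "real \<Rightarrow> real"
  assumes F: "continuous_on UNIV F" and per: "\<And>t. F (t + 2 * pi) = F t" and a: "0 \<le> a" "a \<le> 2 * pi"
  shows "integral {0..2*pi} (\<lambda>t. F (a + t)) = integral {0..2*pi} F"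
proof -
  have int: "F integrable_on {u..v}" for u v
    by (rule integrable_continuous_real, rule continuous_on_subset[OF F]) simp
  have "integral {0..2*pi} (\<lambda>t. F (a + t)) = integral {a..a + 2*pi} F"
    using integral_shift_real_ivl[of a a "a + 2*pi" F] by (simp add: add.commute)
  also have "\<dots> = integral {a..2*pi} F + integral {2*pi..a + 2*pi} F"
    using a by (intro Henstock_Kurzweil_Integration.integral_combine[symmetric] int) auto
  also have "integral {2*pi..a + 2*pi} F = integral {0..a} (\<lambda>t. F (t + 2*pi))"
    using integral_shift_real_ivl[of "2*pi" "2*pi" "a + 2*pi" F] by (simp add: add.commute)
  also have "\<dots> = integral {0..a} F"
    by (simp add: per)
  also have "integral {a..2*pi} F + integral {0..a} F = integral {0..2*pi} F"
    using a by (subst add.commute, intro Henstock_Kurzweil_Integration.integral_combine int) auto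
  finally show ?thesis .
qed

text \<open>This is \<open>2 \<pi>\<close> times the mean of \<open>G\<close> over the circle of radius \<open>r\<close>.\<close>

definition circle_mean :: "(real ^ 2 \<Rightarrow> real) \<Rightarrow> real \<Rightarrow> real" where
  "circle_mean G r = integral {0..2*pi} (\<lambda>\<theta>. G (polar r \<theta>))"

text \<open>Averaging over the circle through \<open>z\<close> is averaging over the rotations of \<open>z\<close>; the starting angle is
  irrelevant by periodicity.\<close>

lemma circle_mean_rotation:
  assumes G: "continuous_on UNIV G"
  shows "circle_mean G (norm z) = integral {0..2*pi} (\<lambda>\<theta>. G (rotation \<theta> z))"
proof -
  obtain \<alpha> where \<alpha>: "0 \<le> \<alpha>" "\<alpha> < 2 * pi" "z = polar (norm z) \<alpha>"
    by (rule polar_surj)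
  have "integral {0..2*pi} (\<lambda>\<theta>. G (rotation \<theta> z)) = integral {0..2*pi} (\<lambda>\<theta>. G (polar (norm z) (\<alpha> + \<theta>)))"
    by (subst \<alpha>(3)) (simp add: rotation_polar)
  also have "\<dots> = integral {0..2*pi} (\<lambda>\<theta>. G (polar (norm z) \<theta>))"
  proof (rule integral_periodic_shift)
    show "continuous_on UNIV (\<lambda>\<theta>. G (polar (norm z) \<theta>))"
      by (intro continuous_on_compose2[OF G] continuous_intros) auto
  qed (use \<alpha>(1,2) in \<open>auto simp: polar_def\<close>)
  finally show ?thesis by (simp add: circle_mean_def)
qed

lemma continuous_circle_mean:
  assumes G: "continuous_on UNIV G"
  shows "continuous_on UNIV (circle_mean G)"
proof -
  have "continuous_on (UNIV \<times> cbox 0 (2 * pi)) (\<lambda>(r, \<theta>). G (polar r \<theta>))"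
    unfolding split_def by (rule continuous_on_compose2[OF G]) (auto intro!: continuous_intros)
  from integral_continuous_on_param[OF this] show ?thesis
    by (simp add: circle_mean_def[abs_def])
qed

text \<open>Each rotation of the kernel is positive semidefinite, being the same kernel at rotated points;
  hence so is the mean.\<close>

lemma circle_mean_pos_def:
  assumes G: "continuous_on UNIV G"
    and psd: "\<And>(N::nat) x c. 0 \<le> (\<Sum>i=1..N. \<Sum>j=1..N. c i * c j * G (x i - x j))"
  shows "pos_def_kernel_on UNIV (\<lambda>x y :: real ^ 2. circle_mean G (norm (x - y)))"
proof (rule pos_def_kernel_onI)
  fix N :: nat and x :: "nat \<Rightarrow> real ^ 2" and c :: "nat \<Rightarrow> real"
  have cont_rot: "continuous_on UNIV (\<lambda>\<theta>. rotation \<theta> z)" for z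
    unfolding rotation_def by (intro continuous_intros)
  have int: "(\<lambda>\<theta>. c i * c j * G (rotation \<theta> (x i - x j))) integrable_on {0..2*pi}" for i j
  proof (rule integrable_continuous_real)
    have "continuous_on UNIV (\<lambda>\<theta>. c i * c j * G (rotation \<theta> (x i - x j)))"
      by (intro continuous_on_mult continuous_on_const continuous_on_compose2[OF G cont_rot]) auto
    then show "continuous_on {0..2*pi} (\<lambda>\<theta>. c i * c j * G (rotation \<theta> (x i - x j)))"
      by (rule continuous_on_subset) simp
  qed
  have "0 \<le> integral {0..2*pi} (\<lambda>\<theta>. \<Sum>i=1..N. \<Sum>j=1..N. c i * c j * G (rotation \<theta> (x i - x j)))"
  proof (rule Henstock_Kurzweil_Integration.integral_nonneg)
    show "(\<lambda>\<theta>. \<Sum>i=1..N. \<Sum>j=1..N. c i * c j * G (rotation \<theta> (x i - x j))) integrable_on {0..2*pi}"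
      by (intro integrable_sum int finite_atLeastAtMost)
    show "0 \<le> (\<Sum>i=1..N. \<Sum>j=1..N. c i * c j * G (rotation \<theta> (x i - x j)))" for \<theta>
      unfolding rotation_diff by (rule psd)
  qed
  also have "\<dots> = (\<Sum>i=1..N. \<Sum>j=1..N. c i * c j * circle_mean G (norm (x i - x j)))"
  proof -
    have "integral {0..2*pi} (\<lambda>\<theta>. \<Sum>i=1..N. \<Sum>j=1..N. c i * c j * G (rotation \<theta> (x i - x j))) =
        (\<Sum>i=1..N. \<Sum>j=1..N. integral {0..2*pi} (\<lambda>\<theta>. c i * c j * G (rotation \<theta> (x i - x j))))"
      by (subst Henstock_Kurzweil_Integration.integral_sum; intro finite_atLeastAtMost integrable_sum int sum.cong refl)
        (rule Henstock_Kurzweil_Integration.integral_sum; intro finite_atLeastAtMost int)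
    then show ?thesis
      unfolding circle_mean_rotation[OF G] by simp
  qed
  finally show "0 \<le> (\<Sum>i=1..N. \<Sum>j=1..N. c i * c j * circle_mean G (norm (x i - x j)))" .
qed (simp add: norm_minus_commute)

text \<open>The real-valued case of the change of variables theorem, obtained by passing through one-dimensional
  vectors.\<close>

lemma integral_change_of_variables_real_valued:
  fixes f :: "real ^ 'm::{finite,wellorder} \<Rightarrow> real" and g :: "real ^ 'm::_ \<Rightarrow> real ^ 'm::_"
  assumes S: "S \<in> sets lebesgue"
    and der_g: "\<And>x. x \<in> S \<Longrightarrow> (g has_derivative g' x) (at x within S)"
    and inj: "inj_on g S"
    and f: "f absolutely_integrable_on g ` S"
  shows "integral (g ` S) f = integral S (\<lambda>x. \<bar>det (matrix (g' x))\<bar> * f (g x))" (is ?eq)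
    and "(\<lambda>x. \<bar>det (matrix (g' x))\<bar> * f (g x)) absolutely_integrable_on S" (is ?int)
proof -
  have "(\<lambda>x. \<bar>det (matrix (g' x))\<bar> *\<^sub>R (vec (f (g x)) :: real ^ 1)) absolutely_integrable_on S \<and>
      integral S (\<lambda>x. \<bar>det (matrix (g' x))\<bar> *\<^sub>R (vec (f (g x)) :: real ^ 1)) = vec b
      \<longleftrightarrow> (\<lambda>x. vec (f x) :: real ^ 1) absolutely_integrable_on (g ` S) \<and>
      integral (g ` S) (\<lambda>x. vec (f x) :: real ^ 1) = vec b" for b
    by (rule has_absolute_integral_change_of_variables[OF S der_g inj])
  then have "?int \<and> integral S (\<lambda>x. \<bar>det (matrix (g' x))\<bar> * f (g x)) = b
      \<longleftrightarrow> f absolutely_integrable_on (g ` S) \<and> integral (g ` S) f = b" for b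
    by (simp add: absolutely_integrable_on_1_iff integral_on_1_eq)
  from this[of "integral (g ` S) f"] show ?eq ?int
    using f by auto
qed

text \<open>Fubini's theorem is about pairs, the change of variables theorem about vectors over a finite index
  type. This identifies the two measures.\<close>

lemma lborel_real2: "distr lborel borel (\<lambda>u. vector [fst u, snd u]) = (lborel :: (real ^ 2) measure)"
proof (rule lborel_eqI[symmetric])
  have [measurable]: "(\<lambda>u :: real \<times> real. vector [fst u, snd u] :: real ^ 2) \<in> borel_measurable borel"
    by (intro borel_measurable_continuous_onI continuous_intros)
  fix l u :: "real ^ 2" assume le: "\<And>b. b \<in> Basis \<Longrightarrow> l \<bullet> b \<le> u \<bullet> b"
  then have le': "l $ 1 \<le> u $ 1" "l $ 2 \<le> u $ 2"
    by (auto simp: cart_eq_inner_axis axis_in_Basis_iff)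
  have "emeasure (distr lborel borel (\<lambda>u. vector [fst u, snd u])) (box l u) =
      emeasure lborel (box (l $ 1, l $ 2) (u $ 1, u $ 2))"
    by (subst emeasure_distr) (auto intro!: arg_cong[where f="emeasure lborel"]
       simp: mem_box Basis_prod_def Basis_vec_def UNIV_2 inner_axis)
  also have "\<dots> = (\<Prod>b\<in>Basis. (u - l) \<bullet> b)"
    using le' by (subst emeasure_lborel_box) (auto simp: Basis_prod_def Basis_vec_def UNIV_2 axis_eq_axis
       prod.union_disjoint inner_axis ennreal_mult)
  finally show "emeasure (distr lborel borel (\<lambda>u. vector [fst u, snd u])) (box l u) = (\<Prod>b\<in>Basis. (u - l) \<bullet> b)" .
qed simp

lemma integral_box_real2:
  fixes f :: "real ^ 2 \<Rightarrow> real"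
  assumes f: "continuous_on UNIV f"
  shows "integral (cbox (vector [a, c]) (vector [b, d])) f = integral {a..b} (\<lambda>x. integral {c..d} (\<lambda>y. f (vector [x, y])))"
proof -
  have m [measurable]: "(\<lambda>u :: real \<times> real. vector [fst u, snd u] :: real ^ 2) \<in> borel_measurable borel"
    by (intro borel_measurable_continuous_onI continuous_intros)
  have [measurable]: "f \<in> borel_measurable borel"
    using f by (rule borel_measurable_continuous_onI)
  have cont: "continuous_on UNIV (\<lambda>u. f (vector [fst u, snd u]))"
    by (intro continuous_on_compose2[OF f] continuous_intros) auto
  have "integral (cbox (vector [a, c]) (vector [b, d])) f = (LINT x:cbox (vector [a, c]) (vector [b, d])|lborel. f x)"
    by (intro set_borel_integral_eq_integral(2)[symmetric] borel_integrable_compact[folded set_integrable_def]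
       compact_cbox continuous_on_subset[OF f]) auto
  also have "\<dots> = (LINT u:cbox (a, c) (b, d)|lborel. f (vector [fst u, snd u]))"
    unfolding set_lebesgue_integral_def
    by (subst lborel_real2[symmetric], subst integral_distr)
       (auto intro!: Bochner_Integration.integral_cong simp: indicator_def mem_box_cart forall_2)
  also have "\<dots> = integral (cbox (a, c) (b, d)) (\<lambda>u. f (vector [fst u, snd u]))"
    by (intro set_borel_integral_eq_integral(2) borel_integrable_compact[folded set_integrable_def]
       compact_cbox continuous_on_subset[OF cont]) auto
  also have "\<dots> = integral {a..b} (\<lambda>x. integral {c..d} (\<lambda>y. f (vector [x, y])))"
    using integral_prod_continuous[OF continuous_on_subset[OF cont], of a c b d] by simp
  finally show ?thesis .
qed

lemma has_derivative_vector_2 [derivative_intros]: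
  assumes "(f has_derivative f') (at x within S)" "(g has_derivative g') (at x within S)"
  shows "((\<lambda>x. vector [f x, g x] :: real ^ 2) has_derivative (\<lambda>h. vector [f' h, g' h])) (at x within S)"
  by (rule has_derivative_componentwise_within[THEN iffD2])
     (use assms in \<open>auto simp: Basis_vec_def UNIV_2 inner_axis\<close>)

lemma absolutely_integrable_continuous_compact:
  fixes f :: "'a::euclidean_space \<Rightarrow> real"
  assumes "compact S" "continuous_on S f"
  shows "f absolutely_integrable_on S"
  using borel_integrable_compact[OF assms] unfolding set_integrable_def
  by (simp add: integrable_completion borel_measurable_integrable)

lemma negligible_coordinate_hyperplane: "negligible {x :: real ^ 'n. x $ k = c}"
  using negligible_hyperplane[of "axis k 1 :: real ^ 'n" c] by (simp add: inner_axis' axis_eq_0_iff)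

text \<open>The coordinates are injective for angles in \<open>[0, 2\<pi>)\<close> and positive radii, and miss only the origin.\<close>

lemma polar_integral:
  fixes F :: "real ^ 2 \<Rightarrow> real"
  assumes F: "continuous_on UNIV F" and R: "0 \<le> R"
  shows "integral (cball 0 R) F = integral {0..R} (\<lambda>r. r * circle_mean F r)"
proof -
  define S where "S = {u :: real ^ 2. 0 < u $ 1 \<and> u $ 1 \<le> R \<and> 0 \<le> u $ 2 \<and> u $ 2 < 2 * pi}"
  define g where "g u = polar (u $ 1) (u $ 2)" for u :: "real ^ 2"
  define g' where "g' u h = (vector [cos (u $ 2) * h $ 1 - u $ 1 * sin (u $ 2) * h $ 2,
     sin (u $ 2) * h $ 1 + u $ 1 * cos (u $ 2) * h $ 2] :: real ^ 2)" for u h :: "real ^ 2"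
  have S: "S \<in> sets lebesgue"
  proof -
    have "S \<in> sets borel" unfolding S_def by measurable
    then show ?thesis by simp
  qed
  have der: "(g has_derivative g' u) (at u within S)" for u
    unfolding g_def polar_def g'_def
    by (auto intro!: derivative_eq_intros bounded_linear.has_derivative[OF bounded_linear_vec_nth] simp: fun_eq_iff algebra_simps)
  have det: "det (matrix (g' u)) = u $ 1" for u
  proof -
    have "det (matrix (g' u)) = u $ 1 * (cos (u $ 2))\<^sup>2 + u $ 1 * (sin (u $ 2))\<^sup>2"
      by (simp add: det_2 matrix_def g'_def axis_def power2_eq_square algebra_simps)
    also have "\<dots> = u $ 1 * ((cos (u $ 2))\<^sup>2 + (sin (u $ 2))\<^sup>2)"
      by (simp only: distrib_left)
    also have "\<dots> = u $ 1"
      by simp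
    finally show ?thesis .
  qed
  have inj: "inj_on g S"
  proof (rule inj_onI)
    fix u v assume u: "u \<in> S" and v: "v \<in> S" and eq: "g u = g v"
    have 1: "u $ 1 = v $ 1"
      using arg_cong[OF eq, of norm] u v by (simp add: g_def S_def)
    then have "sin (u $ 2) = sin (v $ 2) \<and> cos (u $ 2) = cos (v $ 2)"
      using eq u by (auto simp: g_def polar_def vec_eq_iff forall_2 S_def)
    then obtain n :: int where n: "u $ 2 = v $ 2 + 2 * pi * n"
      using sin_cos_eq_iff by blast
    have "\<bar>2 * pi * n\<bar> < 2 * pi"
      using n u v by (auto simp: S_def)
    then have "n = 0"
      by (simp add: abs_mult)
    with n 1 show "u = v" by (simp add: vec_eq_iff forall_2)
  qed
  have img: "g ` S = cball 0 R - {0}"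
  proof (intro equalityI subsetI)
    fix z :: "real ^ 2" assume "z \<in> cball 0 R - {0}"
    moreover obtain \<theta> where "0 \<le> \<theta>" "\<theta> < 2 * pi" "z = polar (norm z) \<theta>"
      by (rule polar_surj)
    ultimately show "z \<in> g ` S"
      by (intro image_eqI[of _ _ "vector [norm z, \<theta>]"]) (auto simp: g_def S_def)
  qed (auto simp: g_def S_def simp flip: norm_le_zero_iff)
  have "F absolutely_integrable_on cball 0 R"
    by (intro absolutely_integrable_continuous_compact continuous_on_subset[OF F]) auto
  then have abs: "F absolutely_integrable_on g ` S"
    unfolding img by (rule set_integrable_subset) auto
  have "integral (cball 0 R) F = integral (g ` S) F"
    unfolding img by (rule integral_spike_set) (auto intro: negligible_subset[of "{0}"])
  also have "\<dots> = integral S (\<lambda>u. \<bar>u $ 1\<bar> * F (g u))"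
    using integral_change_of_variables_real_valued(1)[OF S der inj abs] by (simp add: det)
  also have "\<dots> = integral (cbox (vector [0, 0]) (vector [R, 2 * pi])) (\<lambda>u. \<bar>u $ 1\<bar> * F (g u))"
  proof (rule integral_spike_set)
    show "negligible {u \<in> S - cbox (vector [0, 0]) (vector [R, 2 * pi]). \<bar>u $ 1\<bar> * F (g u) \<noteq> 0}"
      by (rule negligible_subset[of "{}"]) (auto simp: S_def mem_box_cart forall_2)
    show "negligible {u \<in> cbox (vector [0, 0]) (vector [R, 2 * pi]) - S. \<bar>u $ 1\<bar> * F (g u) \<noteq> 0}"
      by (rule negligible_subset[OF negligible_coordinate_hyperplane[of 2 "2 * pi"]])
         (auto simp: S_def mem_box_cart forall_2)
  qed
  also have "\<dots> = integral {0..R} (\<lambda>r. integral {0..2*pi} (\<lambda>\<theta>. \<bar>r\<bar> * F (polar r \<theta>)))"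
    by (subst integral_box_real2) (auto simp: g_def intro!: continuous_intros continuous_on_compose2[OF F])
  also have "\<dots> = integral {0..R} (\<lambda>r. r * circle_mean F r)"
    by (intro Henstock_Kurzweil_Integration.integral_cong) (simp add: circle_mean_def)
  finally show ?thesis .
qed

section \<open>A function in the planar class with negative second Legendre coefficient\<close>

lemma continuous_bump: "continuous_on UNIV (bump e)"
  unfolding bump_def[abs_def] by (intro continuous_intros)

text \<open>The autocorrelation of the masses at the sites, each smeared over a square of side \<open>e\<close>.\<close>

definition smeared :: "real \<Rightarrow> real ^ 2 \<Rightarrow> real" where
  "smeared e z = (\<Sum>p\<in>hexagon. \<Sum>q\<in>hexagon. mass p * mass q * bump e (z - (site p - site q)))"

lemma continuous_smeared: "continuous_on UNIV (smeared e)"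
  unfolding smeared_def[abs_def]
  by (intro continuous_intros continuous_on_compose2[OF continuous_bump]) auto

lemma bump_nonneg: "0 \<le> bump e z"
  by (simp add: bump_def)

lemma bump_zero: "2 * e \<le> norm z \<Longrightarrow> bump e z = 0"
  using norm_le_l1_cart[of z] by (auto simp: bump_def sum_2 max_def)

lemma smeared_zero:
  assumes "3 + 2 * e \<le> norm z"
  shows "smeared e z = 0"
  unfolding smeared_def
proof (intro sum.neutral ballI)
  fix p q assume "p \<in> hexagon" "q \<in> hexagon"
  then have "norm (site p - site q) \<le> 3"
    using norm_triangle_ineq4[of "site p" "site q"] norm_site[of p] norm_site[of q] by linarith
  then have "2 * e \<le> norm (z - (site p - site q))"
    using assms norm_triangle_ineq2[of z "site p - site q"] by linarith
  then show "mass p * mass q * bump e (z - (site p - site q)) = 0"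
    by (simp add: bump_zero)
qed

text \<open>Expanding the definition turns the form into one over pairs (point, site), which consists of overlaps of
  translated squares.\<close>

lemma smeared_pos_semidef:
  fixes N :: nat
  assumes e: "0 < e"
  shows "0 \<le> (\<Sum>i=1..N. \<Sum>j=1..N. c i * c j * smeared e (x i - x j))"
proof -
  let ?I = "{1..N} \<times> hexagon"
  define A where "A u = cbox (x (fst u) - site (snd u)) (x (fst u) - site (snd u) + vec e)" for u :: "nat \<times> int \<times> int"
  define d where "d u = c (fst u) * mass (snd u)" for u :: "nat \<times> int \<times> int"
  have "0 \<le> (\<Sum>u\<in>?I. \<Sum>v\<in>?I. d u * d v * measure lborel (A u \<inter> A v))"
    by (intro overlap_pos_semidef) (auto simp: finite_hexagon A_def fmeasurable_def
        emeasure_lborel_cbox_finite[unfolded infinity_ennreal_def])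
  also have "\<dots> = (\<Sum>u\<in>?I. \<Sum>v\<in>?I. d u * d v *
      bump e ((x (fst u) - site (snd u)) - (x (fst v) - site (snd v))))"
    unfolding A_def bump_overlap[OF e] ..
  also have "\<dots> = (\<Sum>i=1..N. \<Sum>p\<in>hexagon. \<Sum>j=1..N. \<Sum>q\<in>hexagon. d (i,p) * d (j,q) *
      bump e ((x i - x j) - (site p - site q)))"
    by (simp add: sum.cartesian_product' algebra_simps)
  also have "\<dots> = (\<Sum>i=1..N. \<Sum>j=1..N. \<Sum>p\<in>hexagon. \<Sum>q\<in>hexagon. d (i,p) * d (j,q) *
      bump e ((x i - x j) - (site p - site q)))"
    by (intro sum.cong refl) (rule sum.swap)
  also have "\<dots> = (\<Sum>i=1..N. \<Sum>j=1..N. c i * c j * smeared e (x i - x j))"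
    by (simp add: smeared_def d_def sum_distrib_left ac_simps)
  finally show ?thesis .
qed

lemma integral_zero_outside:
  fixes f :: "'a::euclidean_space \<Rightarrow> real"
  assumes "S \<subseteq> T" "\<And>x. x \<in> T - S \<Longrightarrow> f x = 0"
  shows "integral T f = integral S f"
  by (rule integral_spike_set) (rule negligible_subset[of "{}"]; use assms in auto)+

lemma bump_pos_iff: "0 < bump e z \<longleftrightarrow> \<bar>z $ 1\<bar> < e \<and> \<bar>z $ 2\<bar> < e"
  by (auto simp: bump_def zero_less_mult_iff max_def)

text \<open>Translating by \<open>d\<close> moves the support of the bump to a square around the origin. The assumption keeps the
  translated square inside the disc.\<close>

lemma integral_bump_translate:
  assumes V: "continuous_on UNIV V" and le: "norm d + 2 * e \<le> R"
  shows "integral (cball 0 R) (\<lambda>z. bump e (z - d) * V z) =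
     integral (cbox (- vec e) (vec e)) (\<lambda>u. bump e u * V (u + d))"
proof -
  let ?f = "\<lambda>z. bump e (z - d) * V z" and ?B = "cbox (- vec e) (vec e) :: (real ^ 2) set"
  have zero: "bump e (z - d) = 0" if "z \<notin> cball 0 R" for z
    using bump_zero[of e "z - d"] norm_triangle_ineq2[of z d] that le by auto
  have "integral (cball 0 R) ?f = integral UNIV ?f"
    by (rule integral_zero_outside[symmetric]) (use zero in auto)
  also have "\<dots> = integral (cbox (- vec e + d) (vec e + d)) ?f"
  proof (rule integral_zero_outside)
    fix z assume "z \<in> UNIV - cbox (- vec e + d) (vec e + d)"
    then have "\<not> 0 < bump e (z - d)"
      by (auto simp: bump_pos_iff mem_box_cart forall_2)
    then show "?f z = 0"
      using bump_nonneg[of e "z - d"] by simp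
  qed simp
  also have "\<dots> = integral ?B (?f \<circ> (+) d)"
  proof (rule integral_unique[symmetric])
    have "continuous_on UNIV ?f"
      by (intro continuous_on_mult V continuous_on_compose2[OF continuous_bump] continuous_intros) auto
    then have "(?f has_integral integral (cbox (- vec e + d) (vec e + d)) ?f) (cbox (- vec e + d) (vec e + d))"
      by (intro integrable_integral integrable_continuous) (rule continuous_on_subset, auto)
    then show "(?f \<circ> (+) d has_integral integral (cbox (- vec e + d) (vec e + d)) ?f) ?B"
      by (simp only: has_integral_shift_cbox_iff)
  qed
  finally show ?thesis
    by (simp add: o_def add.commute)
qed

text \<open>The energy of the configuration against a copy of itself displaced by \<open>u\<close>. Smearing the masses
  averages this energy over small displacements.\<close>

definition potential :: "real ^ 2 \<Rightarrow> real" where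
  "potential u = (\<Sum>p\<in>hexagon. \<Sum>q\<in>hexagon. mass p * mass q * weight (norm (u + (site p - site q))))"

lemma continuous_weight_norm: "continuous_on UNIV (\<lambda>z :: real ^ 2. weight (norm z))"
  by (rule continuous_on_compose2[OF continuous_weight]) (auto intro!: continuous_intros)

lemma continuous_potential: "continuous_on UNIV potential"
  unfolding potential_def[abs_def]
  by (intro continuous_on_sum continuous_on_mult continuous_on_const
      continuous_on_compose2[OF continuous_weight_norm] continuous_on_add continuous_on_id) auto

lemma smeared_weight_integral:
  assumes e: "0 \<le> e"
  shows "integral (cball 0 (3 + 2 * e)) (\<lambda>z. smeared e z * weight (norm z)) =
    integral (cbox (- vec e) (vec e)) (\<lambda>u. bump e u * potential u)"
proof -
  let ?D = "cball 0 (3 + 2 * e) :: (real ^ 2) set" and ?B = "cbox (- vec e) (vec e) :: (real ^ 2) set"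
  have le: "norm (site p - site q) + 2 * e \<le> 3 + 2 * e" if "p \<in> hexagon" "q \<in> hexagon" for p q
    using norm_triangle_ineq4[of "site p" "site q"] norm_site[OF that(1)] norm_site[OF that(2)] by linarith
  have 1: "(\<lambda>z. mass p * mass q * (bump e (z - (site p - site q)) * weight (norm z))) integrable_on ?D" for p q
  proof -
    have "continuous_on UNIV (\<lambda>z. mass p * mass q * (bump e (z - (site p - site q)) * weight (norm z)))"
      by (intro continuous_on_mult continuous_on_const continuous_weight_norm
          continuous_on_compose2[OF continuous_bump] continuous_intros) auto
    then show ?thesis
      by (intro set_lebesgue_integral_eq_integral(1) absolutely_integrable_continuous_compact)
        (auto intro: continuous_on_subset)
  qed
  have 2: "(\<lambda>u. mass p * mass q * (bump e u * weight (norm (u + (site p - site q))))) integrable_on ?B" for p q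
  proof -
    have "continuous_on UNIV (\<lambda>u. mass p * mass q * (bump e u * weight (norm (u + (site p - site q)))))"
      by (intro continuous_on_mult continuous_on_const continuous_bump
          continuous_on_compose2[OF continuous_weight_norm] continuous_intros) auto
    then show ?thesis
      by (intro integrable_continuous) (auto intro: continuous_on_subset)
  qed
  have "integral ?D (\<lambda>z. smeared e z * weight (norm z)) =
     integral ?D (\<lambda>z. \<Sum>p\<in>hexagon. \<Sum>q\<in>hexagon. mass p * mass q * (bump e (z - (site p - site q)) * weight (norm z)))"
    by (simp add: smeared_def sum_distrib_right mult.assoc)
  also have "\<dots> = (\<Sum>p\<in>hexagon. \<Sum>q\<in>hexagon. mass p * mass q * integral ?D (\<lambda>z. bump e (z - (site p - site q)) * weight (norm z)))"
    using 1 by (simp add: Henstock_Kurzweil_Integration.integral_sum integrable_sum finite_hexagon)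
  also have "\<dots> = (\<Sum>p\<in>hexagon. \<Sum>q\<in>hexagon. mass p * mass q * integral ?B (\<lambda>u. bump e u * weight (norm (u + (site p - site q)))))"
    by (intro sum.cong refl) (simp add: integral_bump_translate[OF continuous_weight_norm le])
  also have "\<dots> = integral ?B (\<lambda>u. \<Sum>p\<in>hexagon. \<Sum>q\<in>hexagon. mass p * mass q * (bump e u * weight (norm (u + (site p - site q)))))"
    using 2 by (simp add: Henstock_Kurzweil_Integration.integral_sum integrable_sum finite_hexagon)
  also have "\<dots> = integral ?B (\<lambda>u. bump e u * potential u)"
    by (simp add: potential_def sum_distrib_left ac_simps)
  finally show ?thesis .
qed

text \<open>The displaced energies are negative for small displacements because the undisplaced one is, and the
  integral weights them with a nonnegative bump supported there. The bound \<open>1/20\<close> makes the support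
  fit: \<open>3 + 2 e \<le> 31/10\<close>.\<close>

lemma smeared_weight_integral_negative:
  obtains e where "0 < e" "e \<le> 1/20"
    "integral (cball 0 (3 + 2 * e)) (\<lambda>z. smeared e z * weight (norm z)) < 0"
proof -
  have "potential 0 < 0"
    using interaction_energy_negative by (simp add: potential_def)
  moreover have "isCont potential 0"
    using continuous_potential by (simp add: continuous_on_eq_continuous_at)
  ultimately have "\<forall>\<^sub>F u in at 0. potential u < 0"
    by (simp add: isCont_def order_tendstoD(2))
  then obtain r where r: "0 < r" "\<And>u. u \<noteq> 0 \<Longrightarrow> dist u 0 < r \<Longrightarrow> potential u < 0"
    unfolding eventually_at by blast
  define e where "e = min (1/20) (r / 2)"
  have e: "0 < e" "e \<le> 1/20" "2 * e \<le> r"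
    using r by (auto simp: e_def)
  have "integral (cbox (- vec e) (vec e)) (\<lambda>u. bump e u * potential u) <
      integral (cbox (- vec e) (vec e)) (\<lambda>u :: real ^ 2. 0)"
  proof (rule Equivalence_Lebesgue_Henstock_Integration.integral_less)
    show "continuous_on (cbox (- vec e) (vec e)) (\<lambda>u. bump e u * potential u)"
      by (rule continuous_on_subset[OF continuous_on_mult[OF continuous_bump continuous_potential]]) simp
    show "box (- vec e) (vec e) \<noteq> ({} :: (real ^ 2) set)"
      using e by (simp add: interval_ne_empty_cart)
    fix u :: "real ^ 2" assume "u \<in> box (- vec e) (vec e)"
    then have u: "\<bar>u $ 1\<bar> < e" "\<bar>u $ 2\<bar> < e"
      by (auto simp: mem_box_cart forall_2)
    then have "norm u < r"
      using norm_le_l1_cart[of u] e by (simp add: sum_2)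
    then have "potential u < 0"
      using r(2)[of u] \<open>potential 0 < 0\<close> by (cases "u = 0") auto
    moreover have "0 < bump e u"
      using u by (simp add: bump_pos_iff)
    ultimately show "bump e u * potential u < 0"
      by (simp add: mult_pos_neg)
  qed simp
  then have "integral (cball 0 (3 + 2 * e)) (\<lambda>z. smeared e z * weight (norm z)) < 0"
    using e by (subst smeared_weight_integral) auto
  with e show ?thesis by (intro that)
qed

theorem Phi_2_example:
  obtains f where "f \<in> Phi_2" "\<And>t. 31/10 \<le> t \<Longrightarrow> f t = 0"
    "integral {0..31/10} (\<lambda>t. f t * legendre_P2 (cos t) * sin t) < 0"
proof -
  obtain e where e: "0 < e" "e \<le> 1/20"
    and neg: "integral (cball 0 (3 + 2 * e)) (\<lambda>z. smeared e z * weight (norm z)) < 0"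
    by (rule smeared_weight_integral_negative)
  \<comment> \<open>The circle of radius \<open>0\<close> is a point, so this is the value at \<open>0\<close> by which to normalise.\<close>
  define Z where "Z = 2 * pi * smeared e 0"
  define G where "G z = smeared e z / Z" for z
  define f where "f = circle_mean G"
  have "0 < smeared e 0"
  proof -
    have "0 < mass (0,0) * mass (0,0) * bump e (0 - (site (0,0) - site (0,0)))"
      using e by (simp add: mass_def bump_pos_iff)
    also have "\<dots> \<le> smeared e 0"
      unfolding smeared_def
      by (rule order.trans[OF _ member_le_sum[of "(0,0)"]], rule member_le_sum)
        (auto simp: finite_hexagon hexagon_def mass_def bump_nonneg intro!: sum_nonneg)
    finally show ?thesis .
  qed
  then have Z: "0 < Z" by (simp add: Z_def)
  have G: "continuous_on UNIV G"
    unfolding G_def by (intro continuous_on_divide continuous_smeared continuous_on_const) (use Z in auto)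
  have G0: "G z = 0" if "31/10 \<le> norm z" for z
    using smeared_zero[of e z] e that by (simp add: G_def)
  have "f \<in> Phi_2"
    unfolding Phi_def
  proof (intro CollectI conjI)
    show "continuous_on {0..} f"
      unfolding f_def by (rule continuous_on_subset[OF continuous_circle_mean[OF G]]) simp
    have "polar 0 \<theta> = 0" for \<theta>
      by (simp add: polar_def vec_eq_iff forall_2)
    then show "f 0 = 1"
      using \<open>0 < smeared e 0\<close> by (simp add: f_def circle_mean_def G_def Z_def)
    show "pos_def_kernel_on UNIV (\<lambda>x y :: real ^ 2. f (norm (x - y)))"
      unfolding f_def
    proof (rule circle_mean_pos_def[OF G])
      fix N :: nat and x :: "nat \<Rightarrow> real ^ 2" and c :: "nat \<Rightarrow> real"
      have "0 \<le> (\<Sum>i=1..N. \<Sum>j=1..N. c i * c j * smeared e (x i - x j)) / Z"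
        using smeared_pos_semidef[OF e(1)] Z by simp
      then show "0 \<le> (\<Sum>i=1..N. \<Sum>j=1..N. c i * c j * G (x i - x j))"
        by (simp add: G_def sum_divide_distrib)
    qed
  qed
  moreover have "f t = 0" if "31/10 \<le> t" for t
    using that G0 by (simp add: f_def circle_mean_def)
  moreover have "integral {0..31/10} (\<lambda>t. f t * legendre_P2 (cos t) * sin t) < 0"
  proof -
    let ?g = "\<lambda>z. G z * weight (norm z)"
    have "integral {0..31/10} (\<lambda>t. f t * legendre_P2 (cos t) * sin t) =
        integral {0..31/10} (\<lambda>t. t * circle_mean ?g t * (1/2))"
    proof (rule Henstock_Kurzweil_Integration.integral_cong)
      fix t :: real assume "t \<in> {0..31/10}"
      then have "circle_mean ?g t = f t * weight t"
        by (simp add: circle_mean_def f_def)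
      then show "f t * legendre_P2 (cos t) * sin t = t * circle_mean ?g t * (1/2)"
        by (simp add: mult.assoc legendre_P2_sin)
    qed
    also have "\<dots> = integral {0..31/10} (\<lambda>t. t * circle_mean ?g t) * (1/2)"
      by (rule integral_mult_left)
    also have "integral {0..31/10} (\<lambda>t. t * circle_mean ?g t) = integral (cball 0 (31/10)) ?g"
      by (intro polar_integral[symmetric] continuous_on_mult G continuous_weight_norm) simp
    also have "\<dots> = integral (cball 0 (3 + 2 * e)) ?g"
      using e smeared_zero[of e] by (intro integral_zero_outside) (auto simp: G_def)
    also have "\<dots> = integral (cball 0 (3 + 2 * e)) (\<lambda>z. (smeared e z * weight (norm z)) * (1 / Z))"
      by (simp add: G_def)
    also have "\<dots> = integral (cball 0 (3 + 2 * e)) (\<lambda>z. smeared e z * weight (norm z)) * (1 / Z)"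
      by (rule integral_mult_left)
    finally show ?thesis
      using neg Z by (simp add: mult_neg_pos divide_neg_pos)
  qed
  ultimately show ?thesis by (rule that)
qed

section \<open>The second Legendre coefficient as a double integral\<close>

text \<open>The entrywise inner product of \<open>x x\<^sup>T\<close> and \<open>y y\<^sup>T\<close> is \<open>(x \<bullet> y)\<^sup>2\<close>; removing the trace from both matrices
  lowers it by \<open>1/3\<close>. This is the addition theorem for spherical harmonics of degree two, without
  the choice of an orthonormal basis.\<close>

lemma legendre_P2_inner:
  fixes x y :: "real ^ 3"
  assumes "norm x = 1" "norm y = 1"
  shows "legendre_P2 (x \<bullet> y) = 3/2 * (\<Sum>a\<in>UNIV. \<Sum>b\<in>UNIV.
    (x $ a * x $ b - (if a = b then 1/3 else 0)) * (y $ a * y $ b - (if a = b then 1/3 else 0)))"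
proof -
  have x: "(x $ 1)\<^sup>2 + (x $ 2)\<^sup>2 + (x $ 3)\<^sup>2 = 1"
    using assms(1) by (simp add: norm_vec_def L2_set_def sum_3)
  have y: "(y $ 1)\<^sup>2 + (y $ 2)\<^sup>2 + (y $ 3)\<^sup>2 = 1"
    using assms(2) by (simp add: norm_vec_def L2_set_def sum_3)
  have "(\<Sum>a\<in>UNIV. \<Sum>b\<in>UNIV. (x $ a * x $ b - (if a = b then 1/3 else 0)) * (y $ a * y $ b - (if a = b then 1/3 else 0)))
    = (x $ 1 * y $ 1 + x $ 2 * y $ 2 + x $ 3 * y $ 3)\<^sup>2
      - ((x $ 1)\<^sup>2 + (x $ 2)\<^sup>2 + (x $ 3)\<^sup>2) / 3 - ((y $ 1)\<^sup>2 + (y $ 2)\<^sup>2 + (y $ 3)\<^sup>2) / 3 + 1/3"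
    unfolding sum_3 by (simp add: power2_eq_square algebra_simps add_divide_distrib)
  moreover have "x \<bullet> y = x $ 1 * y $ 1 + x $ 2 * y $ 2 + x $ 3 * y $ 3"
    by (simp add: inner_vec_def sum_3)
  ultimately show ?thesis
    unfolding x y by (simp add: legendre_P2_def field_simps)
qed

text \<open>Multiplying the coefficients by one entry of the trace-free tensor squares gives a form of \<open>\<psi>\<close>; the
  form in question is the sum of these over all entries.\<close>

lemma Psi_legendre_pos_semidef:
  fixes x :: "'i \<Rightarrow> real ^ 3"
  assumes \<psi>: "\<psi> \<in> Psi_2" and I: "finite I" and x: "\<And>i. i \<in> I \<Longrightarrow> norm (x i) = 1"
  shows "0 \<le> (\<Sum>i\<in>I. \<Sum>j\<in>I. c i * c j * (\<psi> (arccos (x i \<bullet> x j)) * legendre_P2 (x i \<bullet> x j)))"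
proof -
  define Q where "Q a b z = z $ a * z $ b - (if a = b then 1/3 else 0)" for a b :: 3 and z :: "real ^ 3"
  have K: "pos_def_kernel_on (sphere 0 1) (\<lambda>\<xi> \<eta> :: real ^ 3. \<psi> (arccos (\<xi> \<bullet> \<eta>)))"
    using \<psi> by (simp add: Psi_def)
  have "0 \<le> 3/2 * (\<Sum>a\<in>UNIV. \<Sum>b\<in>UNIV. \<Sum>i\<in>I. \<Sum>j\<in>I.
      (c i * Q a b (x i)) * (c j * Q a b (x j)) * \<psi> (arccos (x i \<bullet> x j)))"
    by (intro mult_nonneg_nonneg sum_nonneg pos_def_kernel_onD[OF K I]) (auto simp: x)
  also have "\<dots> = 3/2 * (\<Sum>i\<in>I. \<Sum>j\<in>I. \<Sum>a\<in>UNIV. \<Sum>b\<in>UNIV.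
      (c i * Q a b (x i)) * (c j * Q a b (x j)) * \<psi> (arccos (x i \<bullet> x j)))"
  proof -
    have "(\<Sum>a\<in>A. \<Sum>b\<in>B. \<Sum>i\<in>I. \<Sum>j\<in>J. f a b i j) = (\<Sum>i\<in>I. \<Sum>j\<in>J. \<Sum>a\<in>A. \<Sum>b\<in>B. f a b i j)"
      for f :: "3 \<Rightarrow> 3 \<Rightarrow> 'i \<Rightarrow> 'i \<Rightarrow> real" and A B I J
      by (subst sum.swap[of _ I B], subst sum.swap[of _ I A], subst sum.swap[of _ J B], subst sum.swap[of _ J A], rule refl)
    then show ?thesis by (rule arg_cong)
  qed
  also have "\<dots> = (\<Sum>i\<in>I. \<Sum>j\<in>I. c i * c j * (\<psi> (arccos (x i \<bullet> x j)) * legendre_P2 (x i \<bullet> x j)))"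
    unfolding sum_distrib_left
  proof (intro sum.cong refl)
    fix i j assume "i \<in> I" "j \<in> I"
    then have "legendre_P2 (x i \<bullet> x j) = 3/2 * (\<Sum>a\<in>UNIV. \<Sum>b\<in>UNIV. Q a b (x i) * Q a b (x j))"
      unfolding Q_def by (intro legendre_P2_inner x)
    then show "(\<Sum>a\<in>UNIV. \<Sum>b\<in>UNIV. 3/2 * ((c i * Q a b (x i)) * (c j * Q a b (x j)) * \<psi> (arccos (x i \<bullet> x j))))
        = c i * c j * (\<psi> (arccos (x i \<bullet> x j)) * legendre_P2 (x i \<bullet> x j))"
      by (simp add: sum_distrib_left ac_simps)
  qed
  finally show ?thesis .
qed

text \<open>The map \<open>\<xi>\<close> is approximated by simple functions with values on the sphere; for these the double
  integral is a finite form with the measures of the level sets as coefficients. Dominated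
  convergence does the rest.\<close>

lemma double_integral_nonneg:
  fixes K :: "'b::{real_normed_vector, second_countable_topology} \<Rightarrow> 'b \<Rightarrow> real"
  assumes M: "finite_measure M" and \<xi>: "\<xi> \<in> borel_measurable M" "\<And>x. x \<in> space M \<Longrightarrow> norm (\<xi> x) = 1"
    and K: "continuous_on UNIV (\<lambda>(v, w). K v w)" and bd: "\<And>v w. \<bar>K v w\<bar> \<le> C"
    and psd: "\<And>S c. finite S \<Longrightarrow> S \<subseteq> sphere 0 1 \<Longrightarrow> 0 \<le> (\<Sum>v\<in>S. \<Sum>w\<in>S. c v * c w * K v w)"
  shows "0 \<le> (\<integral>x. (\<integral>y. K (\<xi> x) (\<xi> y) \<partial>M) \<partial>M)"
proof (cases "space M = {}")
  case False
  then obtain x0 where x0: "x0 \<in> space M" by auto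
  interpret finite_measure M by (rule M)
  interpret P: pair_sigma_finite M M ..
  interpret PF: finite_measure "M \<Otimes>\<^sub>M M"
    by (rule finite_measure_pair_measure) (rule M)+
  obtain F where F: "\<And>n. simple_function M (F n)" "\<And>x. x \<in> space M \<Longrightarrow> (\<lambda>n. F n x) \<longlonglongrightarrow> \<xi> x"
    using borel_measurable_implies_sequence_metric[OF \<xi>(1)] by metis
  \<comment> \<open>Normalising brings the values to the sphere; where that is impossible any point of the sphere will do.\<close>
  define E where "E n x = (if F n x = 0 then \<xi> x0 else sgn (F n x))" for n x
  have E_simple: "simple_function M (E n)" for n
    unfolding E_def by (rule simple_function_compose1[OF F(1), of "\<lambda>v. if v = 0 then \<xi> x0 else sgn v"])
  have E_norm: "norm (E n x) = 1" for n x
    using \<xi>(2)[OF x0] by (simp add: E_def norm_sgn)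
  have E_lim: "(\<lambda>n. E n x) \<longlonglongrightarrow> \<xi> x" if x: "x \<in> space M" for x
  proof -
    have nz: "\<xi> x \<noteq> 0" using \<xi>(2)[OF x] by auto
    have "(\<lambda>n. sgn (F n x)) \<longlonglongrightarrow> sgn (\<xi> x)"
      by (intro tendsto_sgn F(2)[OF x] nz)
    moreover have "sgn (\<xi> x) = \<xi> x"
      by (simp add: sgn_div_norm \<xi>(2)[OF x])
    moreover have "\<forall>\<^sub>F n in sequentially. sgn (F n x) = E n x"
      using tendsto_imp_eventually_ne[OF F(2)[OF x] nz] by eventually_elim (simp add: E_def)
    ultimately show ?thesis
      using Lim_transform_eventually by fastforce
  qed
  have E_meas [measurable]: "E n \<in> borel_measurable M" for n
    by (rule borel_measurable_simple_function[OF E_simple])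
  note \<xi>(1)[measurable]
  have K_meas [measurable]: "(\<lambda>u. K (fst u) (snd u)) \<in> borel_measurable borel"
    using K by (intro borel_measurable_continuous_onI) (simp add: split_def)
  have K2: "(\<lambda>u. K (f (fst u)) (g (snd u))) \<in> borel_measurable (M \<Otimes>\<^sub>M M)"
    if [measurable]: "f \<in> borel_measurable M" "g \<in> borel_measurable M" for f g
    using measurable_compose[OF _ K_meas, of "\<lambda>u. (f (fst u), g (snd u))" "M \<Otimes>\<^sub>M M"]
    by simp
  have int: "integrable (M \<Otimes>\<^sub>M M) (\<lambda>u. K (f (fst u)) (g (snd u)))"
    if "f \<in> borel_measurable M" "g \<in> borel_measurable M" for f g
    using K2[OF that] bd by (intro PF.integrable_const_bound[of _ C]) auto
  have lim: "(\<lambda>n. \<integral>u. K (E n (fst u)) (E n (snd u)) \<partial>(M \<Otimes>\<^sub>M M)) \<longlonglongrightarrow>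
      (\<integral>u. K (\<xi> (fst u)) (\<xi> (snd u)) \<partial>(M \<Otimes>\<^sub>M M))"
  proof (rule integral_dominated_convergence[where w="\<lambda>_. C"])
    have K_lim: "(\<lambda>n. K (a n) (b n)) \<longlonglongrightarrow> K a' b'" if "a \<longlonglongrightarrow> a'" "b \<longlonglongrightarrow> b'" for a b a' b'
      using continuous_on_tendsto_compose[OF K tendsto_Pair[OF that]] by simp
    show "AE u in M \<Otimes>\<^sub>M M. (\<lambda>n. K (E n (fst u)) (E n (snd u))) \<longlonglongrightarrow> K (\<xi> (fst u)) (\<xi> (snd u))"
      by (rule AE_I2) (auto simp: space_pair_measure intro!: K_lim E_lim)
  qed (use bd in \<open>auto intro!: K2 \<xi>\<close>)
  have nonneg: "0 \<le> (\<integral>u. K (E n (fst u)) (E n (snd u)) \<partial>(M \<Otimes>\<^sub>M M))" for n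
  proof -
    define A where "A v = E n -` {v} \<inter> space M" for v
    let ?S = "E n ` space M"
    have fin: "finite ?S" using E_simple[of n] by (simp add: simple_function_def)
    have A [measurable]: "A v \<in> sets M" for v
      unfolding A_def by measurable
    have "(\<integral>u. K (E n (fst u)) (E n (snd u)) \<partial>(M \<Otimes>\<^sub>M M)) =
        (\<integral>u. (\<Sum>v\<in>?S. \<Sum>w\<in>?S. K v w * indicator (A v \<times> A w) u) \<partial>(M \<Otimes>\<^sub>M M))"
    proof (rule Bochner_Integration.integral_cong[OF refl])
      fix u assume "u \<in> space (M \<Otimes>\<^sub>M M)"
      then have u: "fst u \<in> space M" "snd u \<in> space M" by (auto simp: space_pair_measure)
      have "(\<Sum>v\<in>?S. \<Sum>w\<in>?S. K v w * indicator (A v \<times> A w) u) =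
          (\<Sum>v\<in>?S. \<Sum>w\<in>?S. if w = E n (snd u) then if v = E n (fst u) then K v w else 0 else 0)"
        using u by (intro sum.cong refl) (auto simp: A_def indicator_def mem_Times_iff)
      also have "\<dots> = K (E n (fst u)) (E n (snd u))"
        using u fin by (simp add: sum.delta)
      finally show "K (E n (fst u)) (E n (snd u)) = (\<Sum>v\<in>?S. \<Sum>w\<in>?S. K v w * indicator (A v \<times> A w) u)" ..
    qed
    also have "\<dots> = (\<Sum>v\<in>?S. \<Sum>w\<in>?S. K v w * measure (M \<Otimes>\<^sub>M M) (A v \<times> A w))"
      by (simp add: Bochner_Integration.integral_sum PF.integrable_const_bound[of _ 1] PF.fmeasurable_eq_sets integrable_indicator_iff less_top[symmetric])
    also have "\<dots> = (\<Sum>v\<in>?S. \<Sum>w\<in>?S. measure M (A v) * measure M (A w) * K v w)"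
      by (simp add: measure_def emeasure_pair_measure_Times enn2real_mult ac_simps)
    also have "0 \<le> \<dots>"
      by (rule psd) (use fin E_norm in auto)
    finally show ?thesis .
  qed
  have "0 \<le> (\<integral>u. K (\<xi> (fst u)) (\<xi> (snd u)) \<partial>(M \<Otimes>\<^sub>M M))"
    by (rule LIMSEQ_le_const[OF lim]) (use nonneg in auto)
  also have "\<dots> = (\<integral>x. (\<integral>y. K (\<xi> x) (\<xi> y) \<partial>M) \<partial>M)"
    using P.integral_fst'[OF int[OF \<xi>(1) \<xi>(1)]] by simp
  finally show ?thesis .
qed (simp add: Bochner_Integration.integral_empty)

section \<open>Integrals of zonal functions over the ball\<close>

lemma continuous_on_vector_3 [continuous_intros]:
  assumes "continuous_on A f" "continuous_on A g" "continuous_on A h"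
  shows "continuous_on A (\<lambda>x. vector [f x, g x, h x] :: real ^ 3)"
proof -
  have "continuous_on A (\<lambda>x. \<chi> i::3. if i = 1 then f x else if i = 2 then g x else h x)"
    by (intro continuous_on_vec_lambda, rename_tac i, case_tac "i = 1", simp add: assms, case_tac "i = 2")
      (simp_all add: assms)
  also have "(\<lambda>x. \<chi> i::3. if i = 1 then f x else if i = 2 then g x else h x) = (\<lambda>x. vector [f x, g x, h x])"
    by (auto simp: fun_eq_iff vec_eq_iff forall_3)
  finally show ?thesis .
qed

lemma Basis_cart: "(Basis :: (real ^ 'n) set) = (\<lambda>i. axis i 1) ` UNIV"
  by (auto simp: Basis_vec_def)

lemma emeasure_lborel_box_cart:
  fixes l u :: "real ^ 'n"
  assumes "\<And>i. l $ i \<le> u $ i"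
  shows "emeasure lborel (box l u) = (\<Prod>i\<in>UNIV. ennreal (u $ i - l $ i))"
proof -
  have "inj (\<lambda>i::'n. axis i (1::real))"
    by (auto intro!: injI simp: axis_eq_axis)
  then have "(\<Prod>b\<in>Basis. (u - l) \<bullet> b) = (\<Prod>i\<in>UNIV. u $ i - l $ i)"
    unfolding Basis_cart by (simp add: prod.reindex inner_axis)
  moreover have "emeasure lborel (box l u) = ennreal (\<Prod>b\<in>Basis. (u - l) \<bullet> b)"
    using assms by (intro emeasure_lborel_box) (auto simp: Basis_cart inner_axis)
  ultimately show ?thesis
    using assms by (simp add: prod_ennreal)
qed

text \<open>The first two coordinates are kept together as a vector of the plane, as in the spherical coordinates
  below.\<close>

lemma lborel_real3:
  "distr lborel borel (\<lambda>u :: (real ^ 2) \<times> real. vector [fst u $ 1, fst u $ 2, snd u]) = (lborel :: (real ^ 3) measure)"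
    (is "distr lborel borel ?g = _")
proof (rule lborel_eqI[symmetric])
  have m: "?g \<in> borel_measurable lborel"
  proof -
    have "continuous_on UNIV ?g"
      by (intro continuous_on_vector_3 continuous_intros)
    from borel_measurable_continuous_onI[OF this] show ?thesis by simp
  qed
  fix l u :: "real ^ 3" assume le: "\<And>b. b \<in> Basis \<Longrightarrow> l \<bullet> b \<le> u \<bullet> b"
  then have le': "l $ i \<le> u $ i" for i
    by (auto simp: cart_eq_inner_axis axis_in_Basis_iff)
  let ?l = "vector [l $ 1, l $ 2] :: real ^ 2" and ?u = "vector [u $ 1, u $ 2] :: real ^ 2"
  have le2: "?l $ i \<le> ?u $ i" for i
    using le' forall_2[of "\<lambda>i. ?l $ i \<le> ?u $ i"] by simp
  have "emeasure (distr lborel borel ?g) (box l u) = emeasure lborel (?g -` box l u)"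
    using m by (subst emeasure_distr) auto
  also have "?g -` box l u = box ?l ?u \<times> box (l $ 3) (u $ 3)"
    by (auto simp: mem_box_cart forall_2 forall_3)
  also have "emeasure lborel (box ?l ?u \<times> box (l $ 3) (u $ 3)) = emeasure lborel (box ?l ?u) * emeasure lborel (box (l $ 3) (u $ 3))"
  proof -
    have "box ?l ?u \<in> sets lborel" "box (l $ 3) (u $ 3) \<in> sets lborel"
      by simp_all
    from lborel.emeasure_pair_measure_Times[OF this] show ?thesis
      by (simp only: lborel_prod)
  qed
  also have "\<dots> = emeasure lborel (box l u)"
  proof -
    have "emeasure lborel (box l u) = ennreal (u $ 1 - l $ 1) * ennreal (u $ 2 - l $ 2) * ennreal (u $ 3 - l $ 3)"
      unfolding emeasure_lborel_box_cart[OF le'] UNIV_3 by (simp add: mult.assoc)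
    moreover have "emeasure lborel (box ?l ?u) = ennreal (u $ 1 - l $ 1) * ennreal (u $ 2 - l $ 2)"
      unfolding emeasure_lborel_box_cart[OF le2] UNIV_2 by simp
    moreover have "emeasure lborel (box (l $ 3) (u $ 3)) = ennreal (u $ 3 - l $ 3)"
      unfolding box_real by (rule emeasure_lborel_Ioo) (rule le')
    ultimately show ?thesis by simp
  qed
  also have "\<dots> = (\<Prod>b\<in>Basis. (u - l) \<bullet> b)"
    using le by (rule emeasure_lborel_box)
  finally show "emeasure (distr lborel borel ?g) (box l u) = (\<Prod>b\<in>Basis. (u - l) \<bullet> b)" .
qed simp

lemma has_derivative_vector_3 [derivative_intros]:
  assumes "(f has_derivative f') (at x within S)" "(g has_derivative g') (at x within S)"
    "(h has_derivative h') (at x within S)"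
  shows "((\<lambda>x. vector [f x, g x, h x] :: real ^ 3) has_derivative (\<lambda>v. vector [f' v, g' v, h' v])) (at x within S)"
  by (rule has_derivative_componentwise_within[THEN iffD2])
     (use assms in \<open>auto simp: Basis_vec_def UNIV_3 inner_axis\<close>)

text \<open>Spherical coordinates with the polar angle \<open>u\<^sub>3\<close>, in which the radius and the azimuth are kept together
  as the planar vector \<open>(u\<^sub>1, u\<^sub>2)\<close>: its norm is the radius. No second angle and no cut along a half-plane
  are needed.\<close>

definition spherical :: "real ^ 3 \<Rightarrow> real ^ 3" where
  "spherical u = vector [sin (u $ 3) * u $ 1, sin (u $ 3) * u $ 2, cos (u $ 3) * sqrt ((u $ 1)\<^sup>2 + (u $ 2)\<^sup>2)]"

definition spherical_dom :: "(real ^ 3) set" where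
  "spherical_dom = {u. 0 < (u $ 1)\<^sup>2 + (u $ 2)\<^sup>2 \<and> (u $ 1)\<^sup>2 + (u $ 2)\<^sup>2 \<le> 1 \<and> 0 < u $ 3 \<and> u $ 3 < pi}"

lemma norm_real3: "(norm z)\<^sup>2 = (z $ 1)\<^sup>2 + (z $ 2)\<^sup>2 + (z $ 3)\<^sup>2" for z :: "real ^ 3"
  by (simp add: norm_vec_def L2_set_def sum_3)

lemma norm_spherical: "norm (spherical u) = sqrt ((u $ 1)\<^sup>2 + (u $ 2)\<^sup>2)"
proof (rule power2_eq_imp_eq)
  have "(norm (spherical u))\<^sup>2 = (sin (u $ 3))\<^sup>2 * ((u $ 1)\<^sup>2 + (u $ 2)\<^sup>2) + (cos (u $ 3))\<^sup>2 * ((u $ 1)\<^sup>2 + (u $ 2)\<^sup>2)"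
    by (simp add: norm_real3 spherical_def power_mult_distrib distrib_left)
  also have "\<dots> = ((sin (u $ 3))\<^sup>2 + (cos (u $ 3))\<^sup>2) * ((u $ 1)\<^sup>2 + (u $ 2)\<^sup>2)"
    by (simp only: distrib_right)
  also have "\<dots> = (sqrt ((u $ 1)\<^sup>2 + (u $ 2)\<^sup>2))\<^sup>2"
    by simp
  finally show "(norm (spherical u))\<^sup>2 = (sqrt ((u $ 1)\<^sup>2 + (u $ 2)\<^sup>2))\<^sup>2" .
qed auto

lemma inj_spherical: "inj_on spherical spherical_dom"
proof (rule inj_onI)
  fix u v assume u: "u \<in> spherical_dom" and v: "v \<in> spherical_dom" and eq: "spherical u = spherical v"
  have r: "sqrt ((u $ 1)\<^sup>2 + (u $ 2)\<^sup>2) = sqrt ((v $ 1)\<^sup>2 + (v $ 2)\<^sup>2)"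
    using arg_cong[OF eq, of norm] by (simp only: norm_spherical)
  have "cos (u $ 3) * sqrt ((u $ 1)\<^sup>2 + (u $ 2)\<^sup>2) = cos (v $ 3) * sqrt ((v $ 1)\<^sup>2 + (v $ 2)\<^sup>2)"
    using arg_cong[OF eq, of "\<lambda>z. z $ 3"] by (simp add: spherical_def)
  moreover have "sqrt ((u $ 1)\<^sup>2 + (u $ 2)\<^sup>2) \<noteq> 0"
    using u by (auto simp: spherical_dom_def sum_power2_gt_zero_iff)
  ultimately have c: "cos (u $ 3) = cos (v $ 3)"
    unfolding r by (metis mult_right_cancel)
  have 3: "u $ 3 = v $ 3"
    by (rule cos_inj_pi[OF _ _ _ _ c]) (use u v in \<open>simp_all add: spherical_dom_def\<close>)
  have "sin (v $ 3) \<noteq> 0"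
    using v sin_gt_zero[of "v $ 3"] by (auto simp: spherical_dom_def)
  moreover have "sin (v $ 3) * u $ 1 = sin (v $ 3) * v $ 1" "sin (v $ 3) * u $ 2 = sin (v $ 3) * v $ 2"
    using arg_cong[OF eq, of "\<lambda>z. z $ 1"] arg_cong[OF eq, of "\<lambda>z. z $ 2"] 3 by (simp_all add: spherical_def)
  ultimately show "u = v"
    using 3 by (simp add: vec_eq_iff forall_3)
qed

lemma spherical_image: "spherical ` spherical_dom = cball 0 1 - {x. x $ 1 = 0 \<and> x $ 2 = 0}"
proof (intro equalityI subsetI)
  fix x assume "x \<in> spherical ` spherical_dom"
  then obtain u where u: "u \<in> spherical_dom" "x = spherical u" by auto
  have "0 < sin (u $ 3)"
    using u by (intro sin_gt_zero) (auto simp: spherical_dom_def)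
  moreover have "u $ 1 \<noteq> 0 \<or> u $ 2 \<noteq> 0"
    using u(1) by (auto simp: spherical_dom_def)
  moreover have "norm x \<le> 1"
    using u by (simp add: norm_spherical spherical_dom_def)
  ultimately show "x \<in> cball 0 1 - {x. x $ 1 = 0 \<and> x $ 2 = 0}"
    using u(2) by (auto simp: spherical_def)
next
  fix x :: "real ^ 3" assume x: "x \<in> cball 0 1 - {x. x $ 1 = 0 \<and> x $ 2 = 0}"
  define r where "r = norm x"
  define t where "t = arccos (x $ 3 / r)"
  have h: "0 < (x $ 1)\<^sup>2 + (x $ 2)\<^sup>2"
    using x by (auto simp: sum_power2_gt_zero_iff)
  have r2: "r\<^sup>2 = (x $ 1)\<^sup>2 + (x $ 2)\<^sup>2 + (x $ 3)\<^sup>2"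
    by (simp add: r_def norm_real3)
  have r: "0 < r" "r \<le> 1"
    using x by (auto simp: r_def)
  have "(x $ 3)\<^sup>2 < r\<^sup>2"
    using h r2 by simp
  then have "\<bar>x $ 3\<bar> < r"
    using r by (intro power2_less_imp_less[of "\<bar>x $ 3\<bar>"]) auto
  then have c: "- 1 < x $ 3 / r" "x $ 3 / r < 1"
    using r by (auto simp: field_simps)
  then have t: "0 < t" "t < pi" "cos t = x $ 3 / r"
    using arccos_lt_bounded[of "x $ 3 / r"] by (auto simp: t_def)
  have s: "0 < sin t" using t by (intro sin_gt_zero)
  have "(sin t)\<^sup>2 * r\<^sup>2 = r\<^sup>2 - (x $ 3)\<^sup>2"
    using r by (simp add: sin_squared_eq t(3) field_simps)
  then have "(x $ 1)\<^sup>2 + (x $ 2)\<^sup>2 = (sin t)\<^sup>2 * r\<^sup>2"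
    using r2 by simp
  then have u2: "(x $ 1 / sin t)\<^sup>2 + (x $ 2 / sin t)\<^sup>2 = r\<^sup>2"
    using s by (simp add: power_divide add_divide_distrib[symmetric])
  let ?u = "vector [x $ 1 / sin t, x $ 2 / sin t, t] :: real ^ 3"
  have "?u \<in> spherical_dom"
    using u2 r t by (simp add: spherical_dom_def power_le_one)
  moreover have "x = spherical ?u"
    using u2 r s t(3) by (simp add: spherical_def vec_eq_iff forall_3)
  ultimately show "x \<in> spherical ` spherical_dom" by blast
qed

definition spherical_deriv :: "real ^ 3 \<Rightarrow> real ^ 3 \<Rightarrow> real ^ 3" where
  "spherical_deriv u h = vector [sin (u $ 3) * h $ 1 + h $ 3 * cos (u $ 3) * u $ 1,
     sin (u $ 3) * h $ 2 + h $ 3 * cos (u $ 3) * u $ 2,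
     cos (u $ 3) * ((u $ 1 * h $ 1 + u $ 2 * h $ 2) / sqrt ((u $ 1)\<^sup>2 + (u $ 2)\<^sup>2))
     - h $ 3 * sin (u $ 3) * sqrt ((u $ 1)\<^sup>2 + (u $ 2)\<^sup>2)]"

lemma has_derivative_spherical:
  assumes "0 < (u $ 1)\<^sup>2 + (u $ 2)\<^sup>2"
  shows "(spherical has_derivative spherical_deriv u) (at u within S)"
proof -
  have nth: "((\<lambda>u :: real ^ 3. u $ i) has_derivative (\<lambda>h. h $ i)) (at u within S)" for i
    by (rule bounded_linear.has_derivative[OF bounded_linear_vec_nth has_derivative_ident])
  have sin: "((\<lambda>u :: real ^ 3. sin (u $ 3)) has_derivative (\<lambda>h. h $ 3 * cos (u $ 3))) (at u within S)"
    using has_derivative_sin[OF nth] .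
  have cos: "((\<lambda>u :: real ^ 3. cos (u $ 3)) has_derivative (\<lambda>h. h $ 3 * - sin (u $ 3))) (at u within S)"
    using has_derivative_cos[OF nth] .
  have sq: "((\<lambda>u :: real ^ 3. (u $ 1)\<^sup>2 + (u $ 2)\<^sup>2) has_derivative (\<lambda>h. 2 * (u $ 1 * h $ 1 + u $ 2 * h $ 2))) (at u within S)"
    unfolding power2_eq_square
    by (rule has_derivative_eq_rhs[OF has_derivative_add[OF has_derivative_mult[OF nth nth] has_derivative_mult[OF nth nth]]])
      (simp add: fun_eq_iff algebra_simps)
  have root: "((\<lambda>u :: real ^ 3. sqrt ((u $ 1)\<^sup>2 + (u $ 2)\<^sup>2)) has_derivative
      (\<lambda>h. (u $ 1 * h $ 1 + u $ 2 * h $ 2) / sqrt ((u $ 1)\<^sup>2 + (u $ 2)\<^sup>2))) (at u within S)"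
  proof (rule has_derivative_eq_rhs)
    show "((\<lambda>u :: real ^ 3. sqrt ((u $ 1)\<^sup>2 + (u $ 2)\<^sup>2)) has_derivative
      (\<lambda>h. 2 * (u $ 1 * h $ 1 + u $ 2 * h $ 2) * (inverse (sqrt ((u $ 1)\<^sup>2 + (u $ 2)\<^sup>2)) / 2))) (at u within S)"
      by (rule has_derivative_real_sqrt[OF _ sq]) (rule assms)
    show "(\<lambda>h. 2 * (u $ 1 * h $ 1 + u $ 2 * h $ 2) * (inverse (sqrt ((u $ 1)\<^sup>2 + (u $ 2)\<^sup>2)) / 2)) =
      (\<lambda>h. (u $ 1 * h $ 1 + u $ 2 * h $ 2) / sqrt ((u $ 1)\<^sup>2 + (u $ 2)\<^sup>2))"
      by (rule ext) (simp only: divide_inverse, simp)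
  qed
  show ?thesis
    unfolding spherical_def[abs_def] spherical_deriv_def[abs_def]
    by (rule has_derivative_eq_rhs[OF has_derivative_vector_3[OF has_derivative_mult[OF sin nth]
        has_derivative_mult[OF sin nth] has_derivative_mult[OF cos root]]])
      (simp add: fun_eq_iff)
qed

text \<open>The area element of the plane already contains one factor of the radius, so a single factor
  remains in place of its square.\<close>

lemma det_spherical:
  assumes "0 < (u $ 1)\<^sup>2 + (u $ 2)\<^sup>2"
  shows "det (matrix (spherical_deriv u)) = - sqrt ((u $ 1)\<^sup>2 + (u $ 2)\<^sup>2) * sin (u $ 3)"
proof -
  define r where "r = sqrt ((u $ 1)\<^sup>2 + (u $ 2)\<^sup>2)"
  have r: "0 < r" "r * r = (u $ 1)\<^sup>2 + (u $ 2)\<^sup>2"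
    using assms by (auto simp: r_def)
  let ?s = "sin (u $ 3)" and ?c = "cos (u $ 3)"
  \<comment> \<open>The factor \<open>r\<close> clears the denominators of the derivative of the norm.\<close>
  have "det (matrix (spherical_deriv u)) * r = - (?s * (?s\<^sup>2 * (r * r) + ?c\<^sup>2 * ((u $ 1)\<^sup>2 + (u $ 2)\<^sup>2)))"
    using r(1) unfolding spherical_deriv_def[abs_def] r_def[symmetric]
    by (simp add: det_3 matrix_def axis_def power2_eq_square field_simps)
  also have "\<dots> = - (?s * ((?s\<^sup>2 + ?c\<^sup>2) * (r * r)))"
    by (simp only: r(2)[symmetric] distrib_right)
  also have "\<dots> = (- r * ?s) * r"
    by simp
  finally have "det (matrix (spherical_deriv u)) = - r * ?s"
    using r(1) by (simp only: mult_right_cancel)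
  then show ?thesis
    by (simp only: r_def)
qed

text \<open>The centre is removed so that every point has a direction \<open>x / |x|\<close>.\<close>

definition solid :: "(real ^ 3) set" where
  "solid = cball 0 1 - {0}"

lemma solid_borel [measurable]: "solid \<in> sets borel"
  by (simp add: solid_def)

lemma emeasure_solid: "emeasure lborel solid < \<infinity>"
  unfolding solid_def by (rule emeasure_bounded_finite) (rule bounded_subset[OF bounded_cball], auto)

lemma measure_solid_pos: "0 < measure lborel solid"
proof -
  have "measure lborel (cball 0 1 - {0 :: real ^ 3}) = measure lborel (cball 0 1 :: (real ^ 3) set)"
    by (rule measure_Diff_null_set) (auto simp: finite_imp_null_set_lborel)
  moreover have "0 < measure lborel (cball 0 1 :: (real ^ 3) set)"
    by (rule content_cball_pos) simp
  ultimately show ?thesis by (simp add: solid_def)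
qed

lemma sgn_measurable [measurable]: "(sgn :: real ^ 3 \<Rightarrow> real ^ 3) \<in> borel_measurable borel"
  unfolding sgn_div_norm[abs_def] by measurable

lemma bounded_absolutely_integrable:
  fixes f :: "'a::euclidean_space \<Rightarrow> real"
  assumes S: "S \<in> sets borel" "bounded S" and f: "f \<in> borel_measurable borel" and C: "\<And>x. \<bar>f x\<bar> \<le> C"
  shows "set_integrable lborel S f" "f absolutely_integrable_on S"
proof -
  have "integrable lborel (\<lambda>x. indicator S x *\<^sub>R f x)"
  proof (rule Bochner_Integration.integrable_bound)
    show "integrable lborel (\<lambda>x. C * indicator S x)"
      using S emeasure_bounded_finite[OF S(2)] by (intro integrable_mult_right) (simp add: integrable_indicator_iff)
    show "AE x in lborel. norm (indicator S x *\<^sub>R f x) \<le> norm (C * indicator S x)"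
      using order.trans[OF C abs_ge_self] by (intro AE_I2) (auto simp: indicator_def abs_mult)
  qed (use S f in measurable)
  then show "set_integrable lborel S f" "f absolutely_integrable_on S"
    unfolding set_integrable_def by (simp_all add: integrable_completion borel_measurable_integrable)
qed

text \<open>Vectors of equal norm are related by an orthogonal transformation. It maps the ball to itself, its
  Jacobian determinant has absolute value \<open>1\<close>, and it commutes with taking directions.\<close>

lemma solid_rotation_invariant:
  fixes h :: "real \<Rightarrow> real"
  assumes h: "continuous_on UNIV h" and bd: "\<And>s. \<bar>h s\<bar> \<le> C" and n: "norm (a :: real ^ 3) = norm b"
  shows "integral solid (\<lambda>x. h (sgn x \<bullet> a)) = integral solid (\<lambda>x. h (sgn x \<bullet> b))"
proof -
  obtain T where T: "orthogonal_transformation T" "T b = a"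
    using orthogonal_transformation_exists[of b a] n by auto
  have lin: "linear T" and nT: "norm (T x) = norm x" for x
    using T by (auto simp: orthogonal_transformation_linear orthogonal_transformation_norm)
  have image: "T ` solid = solid"
  proof (intro equalityI subsetI)
    fix x assume x: "x \<in> solid"
    obtain y where "x = T y"
      using orthogonal_transformation_surj[OF T(1)] by (metis surjD)
    then show "x \<in> T ` solid"
      using x nT[of y] by (auto simp: solid_def linear_0[OF lin] intro!: imageI)
  qed (use nT in \<open>auto simp: solid_def simp flip: norm_le_zero_iff\<close>)
  have hm: "h \<in> borel_measurable borel"
    using h by (rule borel_measurable_continuous_onI)
  have abs: "(\<lambda>x. h (sgn x \<bullet> a)) absolutely_integrable_on T ` solid"
    unfolding image
  proof (rule bounded_absolutely_integrable(2))
    show "bounded solid" unfolding solid_def by (rule bounded_subset[OF bounded_cball]) auto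
    show "(\<lambda>x. h (sgn x \<bullet> a)) \<in> borel_measurable borel"
      by (rule measurable_compose[OF _ hm]) measurable
  qed (use bd solid_borel in auto)
  have "integral solid (\<lambda>x. h (sgn x \<bullet> a)) = integral (T ` solid) (\<lambda>x. h (sgn x \<bullet> a))"
    by (simp add: image)
  also have "\<dots> = integral solid (\<lambda>x. \<bar>det (matrix T)\<bar> * h (sgn (T x) \<bullet> a))"
  proof (rule integral_change_of_variables_real_valued(1)[OF _ _ _ abs])
    show "solid \<in> sets lebesgue" by simp
    show "(T has_derivative T) (at x within solid)" for x
      using lin by (rule linear_imp_has_derivative)
    show "inj_on T solid"
      using orthogonal_transformation_inj[OF T(1)] by (rule inj_on_subset) simp
  qed
  also have "\<dots> = integral solid (\<lambda>x. h (sgn x \<bullet> b))"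
  proof -
    have "sgn (T x) \<bullet> a = sgn x \<bullet> b" for x
    proof -
      have "sgn (T x) \<bullet> a = (T x \<bullet> T b) /\<^sub>R norm x"
        using T by (simp add: sgn_div_norm nT)
      also have "T x \<bullet> T b = x \<bullet> b"
        using T(1) unfolding orthogonal_transformation_def by blast
      finally show ?thesis by (simp add: sgn_div_norm)
    qed
    then show ?thesis
      using orthogonal_transformation_det[OF T(1)] by simp
  qed
  finally show ?thesis .
qed

lemma integral_lborel_times:
  fixes f :: "'a::euclidean_space \<Rightarrow> real" and g :: "'b::euclidean_space \<Rightarrow> real"
  assumes f: "integrable lborel f" and g: "integrable lborel g"
  shows "(\<integral>u. f (fst u) * g (snd u) \<partial>lborel) = (\<integral>x. f x \<partial>lborel) * (\<integral>y. g y \<partial>lborel)"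
proof -
  have [measurable]: "f \<in> borel_measurable borel" "g \<in> borel_measurable borel"
    using f g by (auto dest: borel_measurable_integrable)
  have "integrable (lborel \<Otimes>\<^sub>M lborel) (\<lambda>u. f (fst u) * g (snd u))"
  proof (rule lborel_pair.Fubini_integrable)
    show "integrable lborel (\<lambda>x. \<integral>y. norm (f (fst (x, y)) * g (snd (x, y))) \<partial>lborel)"
      using f by (simp add: abs_mult)
    show "AE x in lborel. integrable lborel (\<lambda>y. f (fst (x, y)) * g (snd (x, y)))"
      using g by simp
  qed measurable
  from lborel_pair.integral_fst'[OF this] show ?thesis
    by (simp add: lborel_prod)
qed

text \<open>Spherical coordinates about the third axis separate the variables. The constant is the integral of the
  norm over the unit disc; only its sign matters later.\<close>

lemma solid_integral_axis:
  obtains A where "\<And>h C. continuous_on UNIV h \<Longrightarrow> (\<And>s. \<bar>h s\<bar> \<le> C) \<Longrightarrow>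
    integral solid (\<lambda>x. h (sgn x \<bullet> axis 3 1)) = A * integral {0..pi} (\<lambda>t. h (cos t) * sin t)"
proof
  let ?D = "{v :: real ^ 2. 0 < (v $ 1)\<^sup>2 + (v $ 2)\<^sup>2 \<and> (v $ 1)\<^sup>2 + (v $ 2)\<^sup>2 \<le> 1}"
  let ?r = "\<lambda>v :: real ^ 2. sqrt ((v $ 1)\<^sup>2 + (v $ 2)\<^sup>2)"
  fix h :: "real \<Rightarrow> real" and C assume h: "continuous_on UNIV h" and bd: "\<And>s. \<bar>h s\<bar> \<le> C"
  have hm [measurable]: "h \<in> borel_measurable borel"
    using h by (rule borel_measurable_continuous_onI)
  have int_t: "set_integrable lborel {0<..<pi} (\<lambda>t. h (cos t) * sin t)"
  proof (rule set_integrable_subset)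
    show "set_integrable lborel {0..pi} (\<lambda>t. h (cos t) * sin t)"
      unfolding set_integrable_def
      by (intro borel_integrable_compact continuous_intros continuous_on_compose2[OF h]) auto
  qed auto
  let ?f = "\<lambda>x :: real ^ 3. h (sgn x \<bullet> axis 3 1)"
  let ?g = "\<lambda>u :: real ^ 3. sqrt ((u $ 1)\<^sup>2 + (u $ 2)\<^sup>2) * (h (cos (u $ 3)) * sin (u $ 3))"
  let ?N = "{x :: real ^ 3. x $ 1 = 0 \<and> x $ 2 = 0}"
  have f_meas: "?f \<in> borel_measurable borel" by measurable
  have dom [measurable]: "spherical_dom \<in> sets borel"
    unfolding spherical_dom_def by measurable
  have "bounded (spherical ` spherical_dom)"
    unfolding spherical_image by (rule bounded_subset[OF bounded_cball]) auto
  moreover have "spherical ` spherical_dom \<in> sets borel"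
    unfolding spherical_image by measurable
  ultimately have abs: "?f absolutely_integrable_on spherical ` spherical_dom"
    by (rule bounded_absolutely_integrable(2)[OF _ _ f_meas bd, rotated])
  have axis: "negligible ?N"
    by (rule negligible_subset[OF negligible_coordinate_hyperplane[of 1 0]]) auto
  have "integral solid ?f = integral (spherical ` spherical_dom) ?f"
    unfolding spherical_image solid_def
    by (rule integral_spike_set; rule negligible_subset[OF axis]) auto
  also have "\<dots> = integral spherical_dom (\<lambda>u. \<bar>det (matrix (spherical_deriv u))\<bar> * ?f (spherical u))"
  proof (rule integral_change_of_variables_real_valued(1)[OF _ _ inj_spherical abs])
    show "spherical_dom \<in> sets lebesgue" by simp
    fix u assume "u \<in> spherical_dom"
    then have "0 < (u $ 1)\<^sup>2 + (u $ 2)\<^sup>2" by (simp only: spherical_dom_def mem_Collect_eq)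
    then show "(spherical has_derivative spherical_deriv u) (at u within spherical_dom)" by (rule has_derivative_spherical)
  qed
  also have "\<dots> = integral spherical_dom ?g"
  proof (rule Henstock_Kurzweil_Integration.integral_cong)
    fix u assume u: "u \<in> spherical_dom"
    then have r: "0 < (u $ 1)\<^sup>2 + (u $ 2)\<^sup>2" and s: "0 < sin (u $ 3)"
      by (auto simp: spherical_dom_def sin_gt_zero)
    let ?R = "sqrt ((u $ 1)\<^sup>2 + (u $ 2)\<^sup>2)"
    have R: "?R \<noteq> 0" using r by (simp only: real_sqrt_eq_0_iff less_imp_neq[symmetric] not_False_eq_True)
    have "sgn (spherical u) \<bullet> axis 3 1 = (spherical u $ 3) / ?R"
      by (simp add: sgn_div_norm norm_spherical inner_axis divide_inverse)
    also have "\<dots> = cos (u $ 3) * ?R / ?R"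
      by (simp only: spherical_def vector_3)
    also have "\<dots> = cos (u $ 3)"
      using R by (rule nonzero_mult_div_cancel_right)
    finally have "sgn (spherical u) \<bullet> axis 3 1 = cos (u $ 3)" .
    then show "\<bar>det (matrix (spherical_deriv u))\<bar> * ?f (spherical u) = ?g u"
      using s by (simp add: det_spherical[OF r] abs_mult)
  qed
  also have "\<dots> = (LINT u:spherical_dom|lborel. ?g u)"
  proof (rule set_borel_integral_eq_integral(2)[symmetric])
    have "continuous_on (cbox (vector [-1, -1, 0]) (vector [1, 1, pi])) ?g"
      by (intro continuous_intros continuous_on_compose2[OF h]) auto
    from borel_integrable_compact[OF compact_cbox this]
    have "set_integrable lborel (cbox (vector [-1, -1, 0]) (vector [1, 1, pi])) ?g"
      by (simp only: set_integrable_def)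
    then show "set_integrable lborel spherical_dom ?g"
    proof (rule set_integrable_subset)
      show "spherical_dom \<subseteq> cbox (vector [-1, -1, 0]) (vector [1, 1, pi])"
      proof
        fix u assume "u \<in> spherical_dom"
        then have u: "(u $ 1)\<^sup>2 + (u $ 2)\<^sup>2 \<le> 1" "0 < u $ 3" "u $ 3 < pi"
          by (simp_all only: spherical_dom_def mem_Collect_eq)
        have "(u $ 1)\<^sup>2 \<le> 1" "(u $ 2)\<^sup>2 \<le> 1"
          using u(1) zero_le_power2[of "u $ 1"] zero_le_power2[of "u $ 2"] by linarith+
        then have "\<bar>u $ 1\<bar> \<le> 1" "\<bar>u $ 2\<bar> \<le> 1"
          by (simp_all only: abs_square_le_1)
        then show "u \<in> cbox (vector [-1, -1, 0]) (vector [1, 1, pi])"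
          using u(2,3) by (simp add: mem_box_cart forall_3 abs_le_iff)
      qed
    qed simp
  qed
  also have "\<dots> = (\<integral>u. indicator ?D (fst u) * ?r (fst u) * (indicator {0<..<pi} (snd u) * (h (cos (snd u)) * sin (snd u))) \<partial>lborel)"
  proof -
    let ?v = "\<lambda>u :: (real ^ 2) \<times> real. vector [fst u $ 1, fst u $ 2, snd u] :: real ^ 3"
    have "continuous_on UNIV ?v"
      by (intro continuous_on_vector_3 continuous_intros)
    then have m: "?v \<in> measurable lborel borel"
      by (simp add: borel_measurable_continuous_onI)
    have ind: "indicator spherical_dom (?v u) = (indicator ?D (fst u) * indicator {0<..<pi} (snd u) :: real)" for u
      by (simp add: indicator_def spherical_dom_def)
    have gm: "(\<lambda>x. indicator spherical_dom x *\<^sub>R ?g x) \<in> borel_measurable borel"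
      by measurable
    have "(LINT u:spherical_dom|lborel. ?g u) = (\<integral>u. indicator spherical_dom (?v u) *\<^sub>R ?g (?v u) \<partial>lborel)"
      unfolding set_lebesgue_integral_def
      by (subst lborel_real3[symmetric], rule integral_distr[OF m gm])
    then show ?thesis
      by (simp add: ind ac_simps)
  qed
  also have "\<dots> = (LINT v:?D|lborel. ?r v) * (LINT t:{0<..<pi}|lborel. h (cos t) * sin t)"
  proof -
    have "set_integrable lborel (cball 0 1) ?r"
      unfolding set_integrable_def by (intro borel_integrable_compact continuous_intros) auto
    then have "set_integrable lborel ?D ?r"
      by (rule set_integrable_subset) (auto simp: norm_real2[symmetric] power_le_one_iff abs_square_le_1)
    from integral_lborel_times[OF this[unfolded set_integrable_def] int_t[unfolded set_integrable_def]]
    show ?thesis by (simp add: set_lebesgue_integral_def)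
  qed
  also have "(LINT t:{0<..<pi}|lborel. h (cos t) * sin t) = integral {0..pi} (\<lambda>t. h (cos t) * sin t)"
    using set_borel_integral_eq_integral(2)[OF int_t] by (simp add: integral_open_interval_real)
  finally show "integral solid ?f = (LINT v:?D|lborel. ?r v) * integral {0..pi} (\<lambda>t. h (cos t) * sin t)" .
qed

text \<open>Rotation invariance reduces every direction to the third axis. The constant is positive because for
  \<open>h = 1\<close> the left side is the volume of the ball.\<close>

lemma solid_integral_zonal:
  obtains A where "0 < A" "\<And>h C a. continuous_on UNIV h \<Longrightarrow> (\<And>s. \<bar>h s\<bar> \<le> C) \<Longrightarrow> norm (a :: real ^ 3) = 1 \<Longrightarrow>
    integral solid (\<lambda>x. h (sgn x \<bullet> a)) = A * integral {0..pi} (\<lambda>t. h (cos t) * sin t)"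
proof -
  obtain A where A: "\<And>h C. continuous_on UNIV h \<Longrightarrow> (\<And>s. \<bar>h s\<bar> \<le> C) \<Longrightarrow>
    integral solid (\<lambda>x. h (sgn x \<bullet> axis 3 1)) = A * integral {0..pi} (\<lambda>t. h (cos t) * sin t)"
    using solid_integral_axis by blast
  have "0 < A"
  proof -
    have "solid \<in> lmeasurable"
      using emeasure_solid by (intro fmeasurableI) auto
    then have "0 < integral solid (\<lambda>x. 1 :: real)"
      using measure_solid_pos by (simp flip: lmeasure_integral)
    also have "\<dots> = A * integral {0..pi} (\<lambda>t. 1 * sin t)"
      by (rule A[of "\<lambda>_. 1" 1]) auto
    finally have "0 < A * integral {0..pi} sin" by simp
    moreover have "0 \<le> integral {0..pi} sin"
      by (intro Henstock_Kurzweil_Integration.integral_nonneg integrable_continuous_real continuous_intros)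
        (auto intro: sin_ge_zero)
    ultimately show ?thesis by (simp add: zero_less_mult_iff)
  qed
  then show ?thesis
  proof (rule that)
    fix h :: "real \<Rightarrow> real" and C and a :: "real ^ 3"
    assume h: "continuous_on UNIV h" "\<And>s. \<bar>h s\<bar> \<le> C" and a: "norm a = 1"
    show "integral solid (\<lambda>x. h (sgn x \<bullet> a)) = A * integral {0..pi} (\<lambda>t. h (cos t) * sin t)"
      using A[OF h] solid_rotation_invariant[OF h, of a "axis 3 1"] a by (simp add: norm_axis_1)
  qed
qed

text \<open>Multiplying \<open>\<psi>\<close> by \<open>P\<^sub>2\<close> and integrating twice over the ball gives a nonnegative number that is a
  positive multiple of the coefficient.\<close>

lemma Psi_integral_nonneg:
  assumes \<psi>: "\<psi> \<in> Psi_2"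
  shows "0 \<le> integral {0..pi} (\<lambda>t. \<psi> t * legendre_P2 (cos t) * sin t)"
proof -
  \<comment> \<open>Clamping to \<open>[-1, 1]\<close> makes the zonal function bounded and continuous on the whole line.\<close>
  define h where "h s = \<psi> (arccos (max (-1) (min 1 s))) * legendre_P2 (max (-1) (min 1 s))" for s
  have cont_\<psi>: "continuous_on {0..pi} \<psi>" using \<psi> by (simp add: Psi_def)
  have h_eq: "h s = \<psi> (arccos s) * legendre_P2 s" if "\<bar>s\<bar> \<le> 1" for s
  proof -
    have "max (-1) (min 1 s) = s" using that by auto
    then show ?thesis by (simp only: h_def)
  qed
  have h: "continuous_on UNIV h"
    unfolding h_def[abs_def] legendre_P2_def
    by (intro continuous_on_mult continuous_on_compose2[OF cont_\<psi>] continuous_on_compose2[OF continuous_on_arccos'] continuous_intros)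
      (auto intro!: arccos_lbound arccos_ubound)
  obtain C where C: "\<And>s. \<bar>h s\<bar> \<le> C"
  proof -
    have "bounded (h ` {-1..1})"
      by (intro compact_imp_bounded compact_continuous_image continuous_on_subset[OF h]) auto
    then obtain C where C: "\<forall>x\<in>h ` {-1..1}. norm x \<le> C"
      unfolding bounded_iff by blast
    have "\<bar>h s\<bar> \<le> C" for s
    proof -
      have "h s = h (max (-1) (min 1 s))"
        by (simp add: h_def)
      moreover have "max (-1) (min 1 s) \<in> {-1..1}"
        by simp
      ultimately show ?thesis using C by (metis image_eqI real_norm_def)
    qed
    then show ?thesis by (rule that)
  qed
  obtain A where A: "0 < A" "\<And>a :: real ^ 3. norm a = 1 \<Longrightarrow>
      integral solid (\<lambda>x. h (sgn x \<bullet> a)) = A * integral {0..pi} (\<lambda>t. h (cos t) * sin t)"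
  proof -
    obtain A where "0 < A" and A: "\<And>h C a. continuous_on UNIV h \<Longrightarrow> (\<And>s. \<bar>h s\<bar> \<le> C) \<Longrightarrow> norm (a :: real ^ 3) = 1 \<Longrightarrow>
        integral solid (\<lambda>x. h (sgn x \<bullet> a)) = A * integral {0..pi} (\<lambda>t. h (cos t) * sin t)"
      by (rule solid_integral_zonal) (blast intro: that)
    then show ?thesis using that h C by blast
  qed
  let ?M = "restrict_space lborel solid"
  interpret M: finite_measure ?M
    using emeasure_solid by (intro finite_measureI) (simp add: emeasure_restrict_space space_restrict_space)
  let ?J = "integral {0..pi} (\<lambda>t. h (cos t) * sin t)"
  have inner: "(\<integral>y. h (sgn y \<bullet> a) \<partial>?M) = A * ?J" if "norm (a :: real ^ 3) = 1" for a
  proof -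
    have hm [measurable]: "h \<in> borel_measurable borel"
      using h by (rule borel_measurable_continuous_onI)
    have "(\<integral>y. h (sgn y \<bullet> a) \<partial>?M) = (LINT y:solid|lborel. h (sgn y \<bullet> a))"
      by (simp add: integral_restrict_space set_lebesgue_integral_def)
    also have "\<dots> = integral solid (\<lambda>y. h (sgn y \<bullet> a))"
    proof (rule set_borel_integral_eq_integral(2), rule bounded_absolutely_integrable(1))
      show "bounded solid" unfolding solid_def by (rule bounded_subset[OF bounded_cball]) auto
      show "(\<lambda>y. h (sgn y \<bullet> a)) \<in> borel_measurable borel" by measurable
    qed (use C in auto)
    finally show ?thesis using A(2)[OF that] by simp
  qed
  have "0 \<le> (\<integral>x. (\<integral>y. h (sgn x \<bullet> sgn y) \<partial>?M) \<partial>?M)"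
  proof (rule double_integral_nonneg)
    show "finite_measure ?M" by (rule M.finite_measure_axioms)
    show "sgn \<in> borel_measurable ?M"
      by (rule measurable_restrict_space1) simp
    show "norm (sgn x) = 1" if "x \<in> space ?M" for x
      using that by (auto simp: space_restrict_space solid_def norm_sgn)
    show "continuous_on UNIV (\<lambda>(v, w). h (v \<bullet> w))"
      unfolding split_def by (intro continuous_on_compose2[OF h] continuous_intros) auto
    show "\<bar>h (v \<bullet> w)\<bar> \<le> C" for v w :: "real ^ 3" by (rule C)
    fix S :: "(real ^ 3) set" and c assume S: "finite S" "S \<subseteq> sphere 0 1"
    have "h (v \<bullet> w) = \<psi> (arccos (v \<bullet> w)) * legendre_P2 (v \<bullet> w)" if "v \<in> S" "w \<in> S" for v w
    proof (rule h_eq)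
      have "norm v = 1" "norm w = 1" using S that by auto
      then show "\<bar>v \<bullet> w\<bar> \<le> 1" using Cauchy_Schwarz_ineq2[of v w] by simp
    qed
    then have "(\<Sum>v\<in>S. \<Sum>w\<in>S. c v * c w * h (v \<bullet> w)) =
        (\<Sum>v\<in>S. \<Sum>w\<in>S. c v * c w * (\<psi> (arccos (v \<bullet> w)) * legendre_P2 (v \<bullet> w)))"
      by (intro sum.cong refl) simp
    also have "0 \<le> \<dots>"
      using S by (intro Psi_legendre_pos_semidef[OF \<psi>, of S "\<lambda>v. v"]) auto
    finally show "0 \<le> (\<Sum>v\<in>S. \<Sum>w\<in>S. c v * c w * h (v \<bullet> w))" .
  qed
  also have "\<dots> = (\<integral>x. A * ?J \<partial>?M)"
    by (intro Bochner_Integration.integral_cong refl)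
      (subst inner_commute, rule inner, auto simp: space_restrict_space solid_def norm_sgn)
  also have "\<dots> = measure lborel solid * (A * ?J)"
    by (simp add: space_restrict_space measure_restrict_space)
  finally have "0 \<le> ?J"
    using measure_solid_pos A(1) by (simp add: zero_le_mult_iff)
  also have "?J = integral {0..pi} (\<lambda>t. \<psi> t * legendre_P2 (cos t) * sin t)"
    by (intro Henstock_Kurzweil_Integration.integral_cong) (simp add: h_eq arccos_cos)
  finally show ?thesis .
qed

section \<open>The counterexample\<close>

theorem theorem1p4:
  "\<exists>f :: real \<Rightarrow> real.
     f \<in> Phi_2 \<and>
     closure (support_on {0..} f) \<subseteq> {0..31/10} \<and>
     {0..31/10} \<subset> {0..<pi} \<and>
     integral {0..31/10} (\<lambda>t. f t * legendre_P2 (cos t) * sin t) < 0 \<and>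
     restrict f {0..pi} \<notin> Psi_2"
proof -
  obtain f where f: "f \<in> Phi_2" and zero: "\<And>t. 31/10 \<le> t \<Longrightarrow> f t = 0"
    and neg: "integral {0..31/10} (\<lambda>t. f t * legendre_P2 (cos t) * sin t) < 0"
    by (rule Phi_2_example) (blast intro: that)
  have pi: "31/10 < pi" using pi_approx by simp
  have "closure (support_on {0..} f) \<subseteq> {0..31/10}"
  proof (rule closure_minimal)
    show "support_on {0..} f \<subseteq> {0..31/10}"
      using zero by (force simp: support_on_def)
  qed simp
  moreover have "{0..31/10} \<subset> {0..<pi}"
    using pi by (auto simp: psubset_eq set_eq_iff intro!: exI[of _ "(31/10 + pi) / 2"])
  moreover have "restrict f {0..pi} \<notin> Psi_2"
  proof
    assume "restrict f {0..pi} \<in> Psi_2"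
    then have "0 \<le> integral {0..pi} (\<lambda>t. restrict f {0..pi} t * legendre_P2 (cos t) * sin t)"
      by (rule Psi_integral_nonneg)
    also have "\<dots> = integral {0..pi} (\<lambda>t. f t * legendre_P2 (cos t) * sin t)"
      by (intro Henstock_Kurzweil_Integration.integral_cong) simp
    also have "\<dots> = integral {0..31/10} (\<lambda>t. f t * legendre_P2 (cos t) * sin t)"
      using pi zero by (intro integral_zero_outside) auto
    finally show False using neg by simp
  qed
  ultimately show ?thesis using f neg by blast
qed

end
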